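(* Let $p\in(1,\infty)$ and let $(V,\mu)$ be an infinite, connected, locally finite weighted graph. Let $\Omega\subset V$ be an infinite subset with $\Omega^c=V\setminus\Omega\neq\emptyset$. Then $\Omega$ is $D_p$-massive if and only if there exists a subset $\Omega_1\subset\Omega$ that is not $p$-parabolic and satisfies $$\operatorname{cap}_p(\Omega_1,\Omega)<\infty.$$
   Context: Weighted graph: $G=(V,E)$ is a graph, $x\sim y$ means that $x,y$ are joined by an edge, and $\mu:V\times V\to[0,\infty)$, $\mu_{xy}=\mu(x,y)=\mu_{yx}$, satisfies $\mu_{xy}>0$ if and only if $x\sim y$. Vertex measure: $\mu(x)=\sum_{y\sim x}\mu_{xy}$. For $u:V\to\mathbb R$, write $\nabla_{xy}u=u(y)-u(x)$ and $\Delta_pu(x)=\frac1{\mu(x)}\sum_{y\sim x}\mu_{xy}|\nabla_{xy}u|^{p-2}\nabla_{xy}u$ (a summand is $0$ when $\nabla_{xy}u=0$). For $W\subset V$ and $f:W\to\mathbb R$ put $D_p(f;W)=\frac12\sum_{x,y\in W}\mu_{xy}|f(x)-f(y)|^p$, and $D_p(f)=D_p(f;V)$. $D_p$-massive: $\Omega\subset V$ is $D_p$-massive if there is $u:V\to\mathbb R$ with $0<u<1$ in $\Omega$, $\Delta_pu=0$ on $\Omega$, $u=1$ on $\Omega^c$, and $D_p(u)<\infty$. Conductance and capacity: $C_p(B_1,B_2;W)=\inf\{D_p(f;W): f:W\to\mathbb R,\ f|_{B_1}=1,\ f|_{B_2}=0,\ D_p(f;W)<\infty\}$, with value $\infty$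 if there is no such $f$. For a possibly infinite set $\Omega_1\subset\Omega$, $\operatorname{cap}_p(\Omega_1,\Omega)$ denotes $C_p(\Omega_1,\Omega^c;V)$. $p$-parabolic: a subset $W\subset V$ is $p$-parabolic if $C_p(K,\infty;W)=0$ for some (and consequently any) nonempty finite $K\subset W$, where $C_p(K,\infty;W)=\inf\{D_p(f;W): f:W\to\mathbb R\text{ finitely supported},\ f=1\text{ on }K\}$. Equivalently, the induced weighted subgraph on $W$ is a $p$-parabolic graph.
   Formalization: The "if" direction is proved only for connected Ω; as printed it fails for disconnected Ω (e.g. when Ω has an extra vertex all of whose neighbours lie in Ω^c). "p-parabolic" is read with every nonempty finite K. *)

theory Defs
  imports "HOL-Analysis.Analysis"
begin

text \<open>
  The vertex set is the whole type. Loops are not excluded; they affect neither the energy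
  nor the zeros of the p-Laplacian.
\<close>

locale weighted_graph =
  fixes E :: "('a \<times> 'a) set" and \<mu> :: "'a \<Rightarrow> 'a \<Rightarrow> real"
  assumes sym_E: "sym E"
    and mu_nonneg: "\<mu> x y \<ge> 0"
    and mu_sym: "\<mu> x y = \<mu> y x"
    and mu_pos_iff: "\<mu> x y > 0 \<longleftrightarrow> (x, y) \<in> E"

definition locally_finite_graph :: "('a \<times> 'a) set \<Rightarrow> bool" where
  "locally_finite_graph E \<longleftrightarrow> (\<forall>x. finite (E `` {x}))"

text \<open>Connectedness of the subgraph induced on \<open>W\<close>.\<close>

definition connected_subgraph :: "('a \<times> 'a) set \<Rightarrow> 'a set \<Rightarrow> bool" where
  "connected_subgraph E W \<longleftrightarrow> (\<forall>x\<in>W. \<forall>y\<in>W. (x, y) \<in> (E \<inter> W \<times> W)\<^sup>*)"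

definition vertex_measure :: "('a \<times> 'a) set \<Rightarrow> ('a \<Rightarrow> 'a \<Rightarrow> real) \<Rightarrow> 'a \<Rightarrow> real" where
  "vertex_measure E \<mu> x = (\<Sum>y\<in>E `` {x}. \<mu> x y)"

text \<open>Since \<open>0 powr a = 0\<close>, summands with vanishing difference are 0 also for \<open>p \<le> 2\<close>.\<close>

definition p_laplacian ::
    "('a \<times> 'a) set \<Rightarrow> ('a \<Rightarrow> 'a \<Rightarrow> real) \<Rightarrow> real \<Rightarrow> ('a \<Rightarrow> real) \<Rightarrow> 'a \<Rightarrow> real" where
  "p_laplacian E \<mu> p u x =
     1 / vertex_measure E \<mu> x *
       (\<Sum>y\<in>E `` {x}. \<mu> x y * \<bar>u y - u x\<bar> powr (p - 2) * (u y - u x))"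

text \<open>
  A function on \<open>W\<close> is represented by a function on the whole type of which only the
  values on \<open>W\<close> are used. Energies and capacities take values in the extended
  nonnegative reals, where the infimum of the empty set is \<open>\<infinity>\<close>.
\<close>

definition p_energy ::
    "('a \<Rightarrow> 'a \<Rightarrow> real) \<Rightarrow> real \<Rightarrow> 'a set \<Rightarrow> ('a \<Rightarrow> real) \<Rightarrow> ennreal" where
  "p_energy \<mu> p W f =
     (\<Sum>\<^sub>\<infinity>(x, y)\<in>W \<times> W. ennreal (\<mu> x y * \<bar>f x - f y\<bar> powr p)) / 2"

definition Dp_massive ::
    "('a \<times> 'a) set \<Rightarrow> ('a \<Rightarrow> 'a \<Rightarrow> real) \<Rightarrow> real \<Rightarrow> 'a set \<Rightarrow> bool" where
  "Dp_massive E \<mu> p \<Omega> \<longleftrightarrow>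
     (\<exists>u :: 'a \<Rightarrow> real.
        (\<forall>x\<in>\<Omega>. 0 < u x \<and> u x < 1) \<and>
        (\<forall>x\<in>\<Omega>. p_laplacian E \<mu> p u x = 0) \<and>
        (\<forall>x\<in>- \<Omega>. u x = 1) \<and>
        p_energy \<mu> p UNIV u < \<infinity>)"

definition p_conductance ::
    "('a \<Rightarrow> 'a \<Rightarrow> real) \<Rightarrow> real \<Rightarrow> 'a set \<Rightarrow> 'a set \<Rightarrow> 'a set \<Rightarrow> ennreal" where
  "p_conductance \<mu> p B1 B2 W =
     Inf {p_energy \<mu> p W f | f.
            (\<forall>x\<in>B1. f x = 1) \<and> (\<forall>x\<in>B2. f x = 0) \<and> p_energy \<mu> p W f < \<infinity>}"

definition p_capacity ::
    "('a \<Rightarrow> 'a \<Rightarrow> real) \<Rightarrow> real \<Rightarrow> 'a set \<Rightarrow> 'a set \<Rightarrow> ennreal" where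
  "p_capacity \<mu> p \<Omega>1 \<Omega> = p_conductance \<mu> p \<Omega>1 (- \<Omega>) UNIV"

definition p_conductance_to_infinity ::
    "('a \<Rightarrow> 'a \<Rightarrow> real) \<Rightarrow> real \<Rightarrow> 'a set \<Rightarrow> 'a set \<Rightarrow> ennreal" where
  "p_conductance_to_infinity \<mu> p K W =
     Inf {p_energy \<mu> p W f | f. finite {x \<in> W. f x \<noteq> 0} \<and> (\<forall>x\<in>K. f x = 1)}"

text \<open>
  Quantifying over every nonempty finite \<open>K\<close> makes the empty set p-parabolic. For
  nonempty connected \<open>W\<close> a single \<open>K\<close> suffices, see \<open>p_parabolic_iff_some\<close> below;
  for disconnected \<open>W\<close> a non-parabolic set is one with some non-parabolic component.
\<close>

definition p_parabolic ::
    "('a \<Rightarrow> 'a \<Rightarrow> real) \<Rightarrow> real \<Rightarrow> 'a set \<Rightarrow> bool" where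
  "p_parabolic \<mu> p W \<longleftrightarrow>
     (\<forall>K. finite K \<and> K \<noteq> {} \<and> K \<subseteq> W \<longrightarrow> p_conductance_to_infinity \<mu> p K W = 0)"

lemma (in weighted_graph) p_energy_ge_edge:
  assumes "x \<in> W" "y \<in> W"
  shows "ennreal (\<mu> x y * \<bar>f x - f y\<bar> powr p / 2) \<le> p_energy \<mu> p W f"
proof -
  let ?g = "\<lambda>(x, y). ennreal (\<mu> x y * \<bar>f x - f y\<bar> powr p)"
  have "infsum ?g {(x, y)} \<le> infsum ?g (W \<times> W)"
    by (rule infsum_mono_neutral) (use assms in \<open>auto intro!: nonneg_summable_on_complete\<close>)
  then have "ennreal (\<mu> x y * \<bar>f x - f y\<bar> powr p) / 2 \<le> infsum ?g (W \<times> W) / 2"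
    by (intro divide_right_mono_ennreal) simp
  also have "ennreal (\<mu> x y * \<bar>f x - f y\<bar> powr p) / 2
             = ennreal (\<mu> x y * \<bar>f x - f y\<bar> powr p / 2)"
    by (metis divide_ennreal ennreal_numeral mu_nonneg mult_nonneg_nonneg powr_ge_zero
        zero_less_numeral zero_le_numeral)
  finally show ?thesis unfolding p_energy_def .
qed

lemma (in weighted_graph) p_energy_contraction:
  assumes "c \<ge> 0" "p > 0" "\<And>x y. \<bar>g x - g y\<bar> \<le> c * \<bar>f x - f y\<bar>"
  shows "p_energy \<mu> p W g \<le> ennreal (c powr p) * p_energy \<mu> p W f"
proof -
  have *: "ennreal (\<mu> x y * \<bar>g x - g y\<bar> powr p)
        \<le> ennreal (c powr p) * ennreal (\<mu> x y * \<bar>f x - f y\<bar> powr p)" for x y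
  proof -
    have "\<bar>g x - g y\<bar> powr p \<le> (c * \<bar>f x - f y\<bar>) powr p"
      using assms by (intro powr_mono2) auto
    also have "\<dots> = c powr p * \<bar>f x - f y\<bar> powr p"
      using assms by (simp add: powr_mult)
    finally have "\<mu> x y * \<bar>g x - g y\<bar> powr p \<le> c powr p * (\<mu> x y * \<bar>f x - f y\<bar> powr p)"
      by (subst mult.left_commute) (rule mult_left_mono[OF _ mu_nonneg])
    then show ?thesis by (simp add: ennreal_leI flip: ennreal_mult')
  qed
  let ?F = "\<lambda>(x, y). ennreal (\<mu> x y * \<bar>f x - f y\<bar> powr p)"
  let ?G = "\<lambda>(x, y). ennreal (\<mu> x y * \<bar>g x - g y\<bar> powr p)"
  have 1: "infsum ?G (W \<times> W) \<le> infsum (\<lambda>z. ennreal (c powr p) * ?F z) (W \<times> W)"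
    by (rule infsum_mono) (use * in \<open>auto intro!: nonneg_summable_on_complete\<close>)
  have 2: "infsum (\<lambda>z. ennreal (c powr p) * ?F z) (W \<times> W) = ennreal (c powr p) * infsum ?F (W \<times> W)"
    unfolding nonneg_infsum_complete[OF zero_le] SUP_mult_left_ennreal sum_distrib_left ..
  show ?thesis
    unfolding p_energy_def ennreal_times_divide
    by (rule divide_right_mono_ennreal) (rule order.trans[OF 1 eq_refl[OF 2]])
qed

lemma (in weighted_graph) value_near_one:
  assumes "p > 0" "(k, v) \<in> (E \<inter> W \<times> W)\<^sup>*" "\<eta> > 0"
  shows "\<exists>\<delta>>0. \<forall>f. p_energy \<mu> p W f < ennreal \<delta> \<longrightarrow> f k = 1 \<longrightarrow> \<bar>f v - 1\<bar> < \<eta>"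
  using assms(2,3)
proof (induction arbitrary: \<eta> rule: rtrancl_induct)
  case base
  then show ?case by (auto intro!: exI[of _ 1])
next
  case (step y z)
  obtain \<delta> where \<delta>: "\<delta> > 0"
    "\<And>f. p_energy \<mu> p W f < ennreal \<delta> \<Longrightarrow> f k = 1 \<Longrightarrow> \<bar>f y - 1\<bar> < \<eta> / 2"
    using step.IH[of "\<eta> / 2"] step.prems by auto
  define \<epsilon> where "\<epsilon> = \<mu> y z * (\<eta> / 2) powr p / 2"
  have yz: "y \<in> W" "z \<in> W" and pos: "\<mu> y z > 0" using step.hyps(2) mu_pos_iff by auto
  have "\<epsilon> > 0" unfolding \<epsilon>_def using pos step.prems by simp
  have "\<bar>f z - 1\<bar> < \<eta>" if f: "p_energy \<mu> p W f < ennreal (min \<delta> \<epsilon>)" "f k = 1" for f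
  proof -
    have lt: "p_energy \<mu> p W f < ennreal \<delta>" "p_energy \<mu> p W f < ennreal \<epsilon>"
      using f(1) by (meson ennreal_leI min.cobounded1 min.cobounded2 order_less_le_trans)+
    have "ennreal (\<mu> y z * \<bar>f y - f z\<bar> powr p / 2) < ennreal \<epsilon>"
      using p_energy_ge_edge[OF yz, of f p] lt(2) by (rule le_less_trans)
    then have "\<bar>f y - f z\<bar> powr p < (\<eta> / 2) powr p"
      using pos \<open>\<epsilon> > 0\<close> by (simp add: ennreal_less_iff \<epsilon>_def)
    then have "\<bar>f y - f z\<bar> < \<eta> / 2"
      using assms(1) step.prems by (meson abs_ge_zero not_le powr_mono2 less_imp_le half_gt_zero)
    moreover have "\<bar>f y - 1\<bar> < \<eta> / 2" using \<delta>(2) lt(1) f(2) by blast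
    ultimately show ?thesis by linarith
  qed
  moreover have "min \<delta> \<epsilon> > 0" using \<delta>(1) \<open>\<epsilon> > 0\<close> by simp
  ultimately show ?case by blast
qed

lemma (in weighted_graph) values_near_one:
  assumes "p > 0" "connected_subgraph E W" "k \<in> W" "finite L" "L \<subseteq> W"
  shows "\<exists>\<delta>>0. \<forall>f. p_energy \<mu> p W f < ennreal \<delta> \<longrightarrow> f k = 1 \<longrightarrow> (\<forall>v\<in>L. f v \<ge> 1 / 2)"
  using assms(4,5)
proof (induction rule: finite_induct)
  case empty
  then show ?case by (auto intro!: exI[of _ 1])
next
  case (insert v L)
  obtain a where a: "a > 0"
    "\<And>f. p_energy \<mu> p W f < ennreal a \<Longrightarrow> f k = 1 \<Longrightarrow> (\<forall>v\<in>L. f v \<ge> 1 / 2)"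
    using insert by auto
  have "(k, v) \<in> (E \<inter> W \<times> W)\<^sup>*"
    using assms(2,3) insert.prems by (auto simp: connected_subgraph_def)
  from value_near_one[OF assms(1) this, of "1 / 2"] obtain b where b: "b > 0"
    "\<And>f. p_energy \<mu> p W f < ennreal b \<Longrightarrow> f k = 1 \<Longrightarrow> \<bar>f v - 1\<bar> < 1 / 2" by auto
  have "\<forall>w\<in>insert v L. f w \<ge> 1 / 2"
    if f: "p_energy \<mu> p W f < ennreal (min a b)" "f k = 1" for f
  proof -
    have "p_energy \<mu> p W f < ennreal a" "p_energy \<mu> p W f < ennreal b"
      using f(1) by (meson ennreal_leI min.cobounded1 min.cobounded2 order_less_le_trans)+
    then have "\<forall>w\<in>L. f w \<ge> 1 / 2" "\<bar>f v - 1\<bar> < 1 / 2"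
      using a(2)[of f] b(2)[of f] f(2) by auto
    moreover from this(2) have "f v \<ge> 1 / 2" by linarith
    ultimately show ?thesis by blast
  qed
  moreover have "min a b > 0" using a b by simp
  ultimately show ?case by blast
qed

lemma (in weighted_graph) p_parabolic_iff_some:
  assumes "p > 0" "connected_subgraph E W" "W \<noteq> {}"
  shows "p_parabolic \<mu> p W \<longleftrightarrow>
    (\<exists>K. finite K \<and> K \<noteq> {} \<and> K \<subseteq> W \<and> p_conductance_to_infinity \<mu> p K W = 0)"
proof
  assume "p_parabolic \<mu> p W"
  moreover obtain w where "w \<in> W" using assms(3) by blast
  ultimately show "\<exists>K. finite K \<and> K \<noteq> {} \<and> K \<subseteq> W \<and> p_conductance_to_infinity \<mu> p K W = 0"
    unfolding p_parabolic_def by (intro exI[of _ "{w}"]) auto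
next
  assume "\<exists>K. finite K \<and> K \<noteq> {} \<and> K \<subseteq> W \<and> p_conductance_to_infinity \<mu> p K W = 0"
  then obtain K k where K: "k \<in> K" "K \<subseteq> W" "p_conductance_to_infinity \<mu> p K W = 0" by blast
  have "p_conductance_to_infinity \<mu> p L W = 0" if L: "finite L" "L \<subseteq> W" for L
  proof -
    obtain \<delta> where \<delta>: "\<delta> > 0"
      "\<And>f. p_energy \<mu> p W f < ennreal \<delta> \<Longrightarrow> f k = 1 \<Longrightarrow> (\<forall>v\<in>L. f v \<ge> 1 / 2)"
      using values_near_one[OF assms(1,2) _ L, of k] K by auto
    have "p_conductance_to_infinity \<mu> p L W \<le> ennreal e" if "e > 0" for e :: real
    proof -
      define d where "d = min \<delta> (e / 2 powr p)"
      have "d > 0" using \<delta>(1) that by (simp add: d_def)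
      then have "p_conductance_to_infinity \<mu> p K W < ennreal d" using K(3) by simp
      then obtain f where f: "finite {x \<in> W. f x \<noteq> 0}" "\<forall>x\<in>K. f x = 1"
          "p_energy \<mu> p W f < ennreal d"
        unfolding p_conductance_to_infinity_def Inf_less_iff by blast
      define g where "g x = min 1 (2 * f x)" for x
      have "d \<le> \<delta>" by (simp add: d_def)
      then have "p_energy \<mu> p W f < ennreal \<delta>"
        using f(3) by (meson ennreal_leI order_less_le_trans)
      then have "\<forall>x\<in>L. f x \<ge> 1 / 2" using \<delta>(2) f(2) K(1) by blast
      then have gL: "\<forall>x\<in>L. g x = 1" by (force simp: g_def)
      have "finite {x \<in> W. g x \<noteq> 0}"
        by (rule finite_subset[OF _ f(1)]) (auto simp: g_def)
      then have "p_conductance_to_infinity \<mu> p L W \<le> p_energy \<mu> p W g"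
        unfolding p_conductance_to_infinity_def using gL by (intro Inf_lower) blast
      also have "\<dots> \<le> ennreal (2 powr p) * p_energy \<mu> p W f"
      proof (rule p_energy_contraction)
        show "\<bar>g x - g y\<bar> \<le> 2 * \<bar>f x - f y\<bar>" for x y
          unfolding g_def min_def by (auto simp: abs_if)
      qed (use assms(1) in auto)
      also have "\<dots> \<le> ennreal (2 powr p) * ennreal d"
        using f(3) by (intro mult_left_mono) auto
      also have "\<dots> \<le> ennreal (2 powr p) * ennreal (e / 2 powr p)"
        by (intro mult_left_mono ennreal_leI) (auto simp: d_def)
      also have "\<dots> = ennreal e"
        using that by (simp flip: ennreal_mult)
      finally show ?thesis .
    qed
    note le = this
    have "p_conductance_to_infinity \<mu> p L W \<le> 0"
    proof (rule ennreal_le_epsilon)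
      show "p_conductance_to_infinity \<mu> p L W \<le> 0 + ennreal e" if "e > 0" for e
        unfolding add_0_left using le that .
    qed
    then show ?thesis by simp
  qed
  then show "p_parabolic \<mu> p W" unfolding p_parabolic_def by blast
qed

text \<open>
  If a vertex of \<open>\<Omega>\<close> has no neighbour in \<open>\<Omega>\<close>, then \<open>\<Omega>\<close> is not massive,
  although the rest of \<open>\<Omega>\<close> may contain a non-parabolic set of finite capacity in
  \<open>\<Omega>\<close>. So the existence of such a set implies massiveness only for connected \<open>\<Omega>\<close>.
\<close>

lemma (in weighted_graph) not_Dp_massive_if_isolated_vertex:
  assumes "locally_finite_graph E" "v \<in> \<Omega>" "E `` {v} \<subseteq> - \<Omega>" "E `` {v} \<noteq> {}"
  shows "\<not> Dp_massive E \<mu> p \<Omega>"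
proof
  assume "Dp_massive E \<mu> p \<Omega>"
  then obtain u where u: "u v < 1" "p_laplacian E \<mu> p u v = 0" "\<forall>x\<in>- \<Omega>. u x = 1"
    using assms(2) unfolding Dp_massive_def by blast
  have fin: "finite (E `` {v})" using assms(1) by (simp add: locally_finite_graph_def)
  have pos: "\<mu> v y > 0" if "y \<in> E `` {v}" for y using that mu_pos_iff by auto
  have "vertex_measure E \<mu> v > 0"
    unfolding vertex_measure_def using fin assms(4) pos by (intro sum_pos) auto
  moreover have "(\<Sum>y\<in>E `` {v}. \<mu> v y * \<bar>u y - u v\<bar> powr (p - 2) * (u y - u v)) > 0"
  proof (intro sum_pos fin assms(4))
    fix y assume y: "y \<in> E `` {v}"
    then have "u y = 1" using u(3) assms(3) by blast
    then show "0 < \<mu> v y * \<bar>u y - u v\<bar> powr (p - 2) * (u y - u v)"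
      using pos[OF y] u(1) by simp
  qed
  ultimately show False using u(2) unfolding p_laplacian_def by simp
qed

end

theory Submission
  imports Defs
begin

text \<open>
  \<^bold>\<open>From massive to a non-parabolic subset.\<close> Let \<open>u\<close> be a function that shows \<open>\<Omega>\<close> to be
  massive, and take the sublevel set \<open>W = {u < s}\<close> at a level \<open>s < 1\<close> at which it is nonempty. It
  lies in \<open>\<Omega>\<close>, and cutting \<open>(1 - u) / (1 - s)\<close> off at \<open>1\<close> bounds its capacity. Since the graph is
  connected, some edge leaves \<open>W\<close>, and \<open>u\<close> increases strictly along it. The flux of \<open>u\<close> through
  this edge cannot disappear at infinity if \<open>W\<close> is parabolic: testing the equation for \<open>u\<close> with
  \<open>f * max 0 (s - u)\<close>, where \<open>f\<close> is a finitely supported function on \<open>W\<close> with value \<open>1\<close> at the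
  inner end of the edge, shows that a fixed positive number is at most
  \<open>\<Sum> \<mu> x y |u x - u y|^(p - 1) |f x - f y|\<close> over \<open>W\<close>, and by Young's inequality this is small when
  the energy of \<open>f\<close> on \<open>W\<close> is small. The estimate is \<open>sublevel_flux_bound\<close>.

  \<^bold>\<open>From a non-parabolic subset to massive.\<close> Finite capacity yields \<open>f\<close> with values in \<open>[0, 1]\<close> and
  finite energy that is \<open>1\<close> on \<open>\<Omega>1\<close> and \<open>0\<close> outside \<open>\<Omega>\<close>. Minimize the energy among the functions
  that differ from \<open>f\<close> on a finite subset of \<open>\<Omega>\<close>. Uniform convexity of \<open>t \<mapsto> |t|^p\<close> makes a
  minimizing sequence \<open>g n\<close> Cauchy for the energy. As all \<open>g n\<close> vanish outside \<open>\<Omega>\<close>, which is not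
  empty, and a small energy controls each edge difference, the sequence converges pointwise on the
  connected graph, to \<open>v\<close> say. Changing \<open>g n\<close> at a single vertex of \<open>\<Omega>\<close> affects only finitely
  many terms of the energy, so \<open>v\<close> is minimal with respect to such changes, that is, p-harmonic
  on \<open>\<Omega>\<close>. If \<open>v\<close> were \<open>0\<close>, the energies of \<open>g n\<close> would tend to \<open>0\<close>, and the functions \<open>1 - g n\<close>,
  which have finite support on \<open>\<Omega>1\<close> and tend to \<open>1\<close>, would show that \<open>\<Omega>1\<close> is parabolic. So \<open>v\<close> is
  not \<open>0\<close>, and the strong maximum principle gives \<open>0 < v < 1\<close> on \<open>\<Omega>\<close>: a zero of \<open>v\<close> would spread
  over the connected set \<open>\<Omega>\<close>, a value \<open>1\<close> over the whole graph. Then \<open>1 - v\<close> shows that \<open>\<Omega>\<close> is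
  massive.
\<close>

section \<open>Convexity of the power function\<close>

lemma has_real_derivative_abs_powr:
  fixes p :: real
  assumes "1 < p"
  shows "((\<lambda>t. \<bar>t\<bar> powr p) has_real_derivative p * (\<bar>a\<bar> powr (p - 2) * a)) (at a)"
proof -
  have pow: "x powr (p - 1) = x powr (p - 2) * x" if "0 < x" for x :: real
    using that powr_add[of x "p - 2" 1] by simp
  consider "a > 0" | "a < 0" | "a = 0" by linarith
  then show ?thesis
  proof cases
    case 1
    have "((\<lambda>t. t powr p) has_real_derivative p * a powr (p - 1)) (at a)"
      using 1 by (auto intro!: derivative_eq_intros)
    moreover have "\<forall>\<^sub>F t in nhds a. \<bar>t\<bar> powr p = t powr p"
      using 1 by (intro eventually_mono[OF eventually_nhds_in_open[of "{0<..}"]]) auto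
    ultimately show ?thesis
      using 1 by (subst DERIV_cong_ev[OF refl _ refl]) (auto simp: pow)
  next
    case 2
    have "((\<lambda>t. (- t) powr p) has_real_derivative - (p * (- a) powr (p - 1))) (at a)"
      using 2 by (auto intro!: derivative_eq_intros)
    moreover have "\<forall>\<^sub>F t in nhds a. \<bar>t\<bar> powr p = (- t) powr p"
      using 2 by (intro eventually_mono[OF eventually_nhds_in_open[of "{..<0}"]]) auto
    ultimately show ?thesis
      using 2 by (subst DERIV_cong_ev[OF refl _ refl]) (auto simp: pow)
  next
    case 3
    have "((\<lambda>h. \<bar>h\<bar> powr (p - 1)) \<longlongrightarrow> 0) (at (0::real))"
      by (rule tendsto_zero_powrI[OF tendsto_rabs_zero[OF tendsto_ident_at] tendsto_const])
         (use assms in auto)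
    moreover have "\<forall>\<^sub>F h in at (0::real). norm (\<bar>h\<bar> powr p / h) \<le> \<bar>h\<bar> powr (p - 1)"
    proof -
      have "norm (\<bar>h\<bar> powr p / h) \<le> \<bar>h\<bar> powr (p - 1)" if "h \<noteq> 0" for h :: real
        using that powr_diff[of "\<bar>h\<bar>" p 1] by simp
      then show ?thesis unfolding eventually_at_filter by (intro always_eventually) blast
    qed
    ultimately have "((\<lambda>h. \<bar>h\<bar> powr p / h) \<longlongrightarrow> 0) (at (0::real))"
      by (rule Lim_null_comparison[rotated])
    then show ?thesis using 3 by (simp add: has_field_derivative_iff)
  qed
qed

lemma continuous_on_abs_powr:
  fixes f :: "'b::topological_space \<Rightarrow> real"
  assumes "1 < p" "continuous_on S f"
  shows "continuous_on S (\<lambda>x. \<bar>f x\<bar> powr p)"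
proof -
  have "continuous_on UNIV (\<lambda>t::real. \<bar>t\<bar> powr p)"
    by (rule DERIV_continuous_on) (rule has_real_derivative_abs_powr[OF assms(1), THEN has_field_derivative_at_within])
  from continuous_on_compose2[OF this assms(2)] show ?thesis by simp
qed

lemma tendsto_abs_powr:
  assumes "1 < p" "(f \<longlongrightarrow> (l::real)) F"
  shows "((\<lambda>x. \<bar>f x\<bar> powr p) \<longlongrightarrow> \<bar>l\<bar> powr p) F"
  using DERIV_isCont[OF has_real_derivative_abs_powr[OF assms(1)]] assms(2)
  by (rule isCont_tendsto_compose)

text \<open>
  The derivative of \<open>t \<mapsto> |t|^p\<close>, up to the factor \<open>p\<close>, increases strictly on the whole line; this
  is where \<open>p > 1\<close> makes the power strictly convex.
\<close>

lemma signed_power_strict_mono: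
  fixes a b p :: real
  assumes "1 < p" "a < b"
  shows "\<bar>a\<bar> powr (p - 2) * a < \<bar>b\<bar> powr (p - 2) * b"
proof -
  have pow: "\<bar>x\<bar> powr (p - 2) * x = sgn x * \<bar>x\<bar> powr (p - 1)" for x :: real
    using powr_add[of "\<bar>x\<bar>" "p - 2" 1] by (cases "x = 0") (auto simp: sgn_if abs_if)
  have mono: "x powr (p - 1) < y powr (p - 1)" if "0 \<le> x" "x < y" for x y :: real
    using that assms(1) by (intro powr_less_mono2) auto
  consider "0 \<le> a" | "a < 0" "0 < b" | "b \<le> 0" by linarith
  then show ?thesis
  proof cases
    case 1
    then show ?thesis unfolding pow using mono[of a b] assms(2) by (auto simp: sgn_if)
  next
    case 2
    then show ?thesis by (smt (verit) mult_neg_pos mult_pos_pos powr_gt_zero mult.commute)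
  next
    case 3
    then show ?thesis unfolding pow using mono[of "- b" "- a"] assms(2) by (auto simp: sgn_if)
  qed
qed

lemma abs_powr_midpoint_less:
  fixes a b p :: real
  assumes "1 < p" "a \<noteq> b"
  shows "\<bar>(a + b) / 2\<bar> powr p < (\<bar>a\<bar> powr p + \<bar>b\<bar> powr p) / 2"
proof -
  have *: "\<bar>(a + b) / 2\<bar> powr p < (\<bar>a\<bar> powr p + \<bar>b\<bar> powr p) / 2" if ab: "a < b" for a b :: real
  proof -
    let ?\<phi> = "\<lambda>t. p * (\<bar>t\<bar> powr (p - 2) * t)" and ?c = "(a + b) / 2"
    obtain x where x: "a < x" "x < ?c" "\<bar>?c\<bar> powr p - \<bar>a\<bar> powr p = (?c - a) * ?\<phi> x"
      using MVT2[of a ?c "\<lambda>t. \<bar>t\<bar> powr p" ?\<phi>] ab has_real_derivative_abs_powr[OF assms(1)] by auto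
    obtain y where y: "?c < y" "y < b" "\<bar>b\<bar> powr p - \<bar>?c\<bar> powr p = (b - ?c) * ?\<phi> y"
      using MVT2[of ?c b "\<lambda>t. \<bar>t\<bar> powr p" ?\<phi>] ab has_real_derivative_abs_powr[OF assms(1)] by auto
    have "?\<phi> x < ?\<phi> y"
      using signed_power_strict_mono[OF assms(1), of x y] x y assms(1)
      by (intro mult_strict_left_mono) auto
    then have "(b - a) / 2 * ?\<phi> x < (b - a) / 2 * ?\<phi> y"
      by (rule mult_strict_left_mono) (use ab in auto)
    moreover have half: "?c - a = (b - a) / 2" "b - ?c = (b - a) / 2" by (simp_all add: field_simps)
    ultimately have "\<bar>?c\<bar> powr p - \<bar>a\<bar> powr p < \<bar>b\<bar> powr p - \<bar>?c\<bar> powr p"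
      unfolding x(3) y(3) half by blast
    then show ?thesis by simp
  qed
  show ?thesis
    using *[of a b] *[of b a] assms(2) by (cases "a < b") (auto simp: add.commute)
qed

lemma abs_powr_midpoint_le:
  fixes a b p :: real
  assumes "1 < p"
  shows "\<bar>(a + b) / 2\<bar> powr p \<le> (\<bar>a\<bar> powr p + \<bar>b\<bar> powr p) / 2"
  using abs_powr_midpoint_less[OF assms, of a b] by (cases "a = b") auto

text \<open>
  Uniform convexity in the place of Clarkson's inequalities, with one form for all \<open>p > 1\<close>. Both
  sides are homogeneous of degree \<open>p\<close>, so \<open>|a|^p + |b|^p = 1\<close> may be assumed. Where
  \<open>|a - b|^p \<ge> \<delta>\<close>, the convexity gap at the midpoint has a positive minimum by compactness, and a
  large multiple of it absorbs \<open>|a - b|^p \<le> 2^p\<close>; elsewhere \<open>|a - b|^p\<close> is paid for by \<open>\<delta>\<close>.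
\<close>

lemma abs_powr_uniformly_convex:
  fixes p \<delta> :: real
  assumes p: "1 < p" and \<delta>: "0 < \<delta>"
  shows "\<exists>C>0. \<forall>a b. \<bar>a - b\<bar> powr p + C * \<bar>(a + b) / 2\<bar> powr p
           \<le> (\<delta> + C / 2) * (\<bar>a\<bar> powr p + \<bar>b\<bar> powr p)"
proof -
  define gap where "gap = (\<lambda>z::real \<times> real.
    (\<bar>fst z\<bar> powr p + \<bar>snd z\<bar> powr p) / 2 - \<bar>(fst z + snd z) / 2\<bar> powr p)"
  define S where "S = ({-1..1} \<times> {-1..1}) \<inter>
    {z::real \<times> real. \<bar>fst z\<bar> powr p + \<bar>snd z\<bar> powr p = 1 \<and> \<delta> \<le> \<bar>fst z - snd z\<bar> powr p}"
  have "compact S" unfolding S_def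
  proof (intro compact_Int_closed compact_Times compact_Icc)
    show "closed {z::real \<times> real. \<bar>fst z\<bar> powr p + \<bar>snd z\<bar> powr p = 1 \<and> \<delta> \<le> \<bar>fst z - snd z\<bar> powr p}"
      by (intro closed_Collect_conj closed_Collect_eq closed_Collect_le continuous_intros
            continuous_on_abs_powr[OF p])
  qed
  have "continuous_on S gap" unfolding gap_def
    by (intro continuous_intros continuous_on_abs_powr[OF p]) auto
  have pos: "gap z > 0" if "z \<in> S" for z
  proof -
    have "fst z \<noteq> snd z" using that p \<delta> by (auto simp: S_def)
    then show ?thesis unfolding gap_def using abs_powr_midpoint_less[OF p] by fastforce
  qed
  obtain c where c: "c > 0" "\<And>z. z \<in> S \<Longrightarrow> c \<le> gap z"
  proof (cases "S = {}")
    case True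
    then show ?thesis using that[of 1] by simp
  next
    case False
    from continuous_attains_inf[OF \<open>compact S\<close> this \<open>continuous_on S gap\<close>]
    show ?thesis using that pos by blast
  qed
  define C where "C = 2 powr p / c"
  have "C > 0" using c by (simp add: C_def)
  have normalized: "\<bar>a - b\<bar> powr p + C * \<bar>(a + b) / 2\<bar> powr p \<le> \<delta> + C / 2"
    if ab: "\<bar>a\<bar> powr p + \<bar>b\<bar> powr p = 1" for a b :: real
  proof (cases "\<bar>a - b\<bar> powr p < \<delta>")
    case True
    have "C * \<bar>(a + b) / 2\<bar> powr p \<le> C * (1 / 2)"
      using abs_powr_midpoint_le[OF p, of a b] ab \<open>C > 0\<close> by (intro mult_left_mono) auto
    then show ?thesis using True by simp
  next
    case False
    have bound: "\<bar>x\<bar> \<le> 1" if "\<bar>x\<bar> powr p \<le> 1" for x :: real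
      using that p by (smt (verit) powr_less_mono2 powr_one_eq_one)
    have "\<bar>a\<bar> \<le> 1" "\<bar>b\<bar> \<le> 1"
      using bound[of a] bound[of b] ab by (smt (verit) powr_ge_zero)+
    then have "(a, b) \<in> S" using False ab by (auto simp: S_def abs_le_iff)
    from c(2)[OF this] have "c \<le> 1 / 2 - \<bar>(a + b) / 2\<bar> powr p" using ab by (simp add: gap_def)
    then have "C * c \<le> C * (1 / 2 - \<bar>(a + b) / 2\<bar> powr p)"
      using \<open>C > 0\<close> by (intro mult_left_mono) auto
    moreover have "C * c = 2 powr p" using c by (simp add: C_def)
    moreover have "\<bar>a - b\<bar> powr p \<le> 2 powr p"
      using \<open>\<bar>a\<bar> \<le> 1\<close> \<open>\<bar>b\<bar> \<le> 1\<close> p by (intro powr_mono2) auto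
    ultimately show ?thesis using \<delta> by (simp add: algebra_simps)
  qed
  have "\<bar>a - b\<bar> powr p + C * \<bar>(a + b) / 2\<bar> powr p
          \<le> (\<delta> + C / 2) * (\<bar>a\<bar> powr p + \<bar>b\<bar> powr p)" for a b :: real
  proof (cases "a = 0 \<and> b = 0")
    case True
    then show ?thesis by simp
  next
    case False
    define s where "s = \<bar>a\<bar> powr p + \<bar>b\<bar> powr p"
    define r where "r = s powr (1 / p)"
    have "s > 0" unfolding s_def using False
      by (smt (verit) powr_gt_zero powr_ge_zero)
    then have "r > 0" by (simp add: r_def)
    have rp: "r powr p = s" using p \<open>s > 0\<close> by (simp add: r_def powr_powr)
    have scale: "\<bar>x / r\<bar> powr p = \<bar>x\<bar> powr p / s" for x
      using \<open>r > 0\<close> by (simp add: powr_divide rp)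
    have "\<bar>a / r\<bar> powr p + \<bar>b / r\<bar> powr p = 1"
      using \<open>s > 0\<close> unfolding scale by (simp add: s_def flip: add_divide_distrib)
    from normalized[OF this]
    have "\<bar>a / r - b / r\<bar> powr p + C * \<bar>(a / r + b / r) / 2\<bar> powr p \<le> \<delta> + C / 2" .
    moreover have "a / r - b / r = (a - b) / r" "(a / r + b / r) / 2 = ((a + b) / 2) / r"
      by (simp_all add: diff_divide_distrib add_divide_distrib)
    ultimately have "\<bar>a - b\<bar> powr p / s + C * (\<bar>(a + b) / 2\<bar> powr p / s) \<le> \<delta> + C / 2"
      by (simp only: scale)
    then have "(\<bar>a - b\<bar> powr p + C * \<bar>(a + b) / 2\<bar> powr p) / s \<le> \<delta> + C / 2"
      by (simp add: add_divide_distrib)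
    then show ?thesis using \<open>s > 0\<close> unfolding s_def[symmetric] by (simp add: pos_divide_le_eq)
  qed
  then show ?thesis using \<open>C > 0\<close> by blast
qed

text \<open>
  A weak form of Young's inequality with a free small parameter, by comparing \<open>|b|\<close> with
  \<open>\<delta> |a|\<close>.
\<close>

lemma abs_powr_young:
  fixes a b p \<delta> :: real
  assumes "1 < p" "0 < \<delta>"
  shows "\<bar>a\<bar> powr (p - 1) * \<bar>b\<bar> \<le> \<delta> * \<bar>a\<bar> powr p + \<delta> powr (1 - p) * \<bar>b\<bar> powr p"
proof (cases "\<bar>b\<bar> \<le> \<delta> * \<bar>a\<bar>")
  case True
  have "\<bar>a\<bar> powr (p - 1) * \<bar>b\<bar> \<le> \<bar>a\<bar> powr (p - 1) * (\<delta> * \<bar>a\<bar>)"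
    using True by (intro mult_left_mono) auto
  also have "\<dots> = \<delta> * \<bar>a\<bar> powr p"
    using powr_add[of "\<bar>a\<bar>" "p - 1" 1] by (cases "a = 0") auto
  finally show ?thesis by (smt (verit) powr_ge_zero mult_nonneg_nonneg)
next
  case False
  then have "\<bar>a\<bar> \<le> \<bar>b\<bar> / \<delta>" using assms(2) by (simp add: field_simps)
  then have "\<bar>a\<bar> powr (p - 1) * \<bar>b\<bar> \<le> (\<bar>b\<bar> / \<delta>) powr (p - 1) * \<bar>b\<bar>"
    using assms(1) by (intro mult_right_mono powr_mono2) auto
  also have "\<dots> = \<delta> powr (1 - p) * \<bar>b\<bar> powr p"
    using assms(2) powr_add[of "\<bar>b\<bar>" "p - 1" 1] powr_minus_divide[of \<delta> "p - 1"]
    by (cases "b = 0") (auto simp: powr_divide)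
  finally show ?thesis using assms(2) by (smt (verit) powr_ge_zero mult_nonneg_nonneg)
qed

section \<open>Energies as real sums over edges\<close>

text \<open>
  Each edge appears as two ordered pairs, so the sum of \<open>edge_energy \<mu> p f\<close> over all pairs in
  \<open>W \<times> W\<close> is twice the p-energy of \<open>f\<close> on \<open>W\<close>. The terms are real numbers, in order that
  energies can be subtracted.
\<close>

definition edge_energy :: "('a \<Rightarrow> 'a \<Rightarrow> real) \<Rightarrow> real \<Rightarrow> ('a \<Rightarrow> real) \<Rightarrow> 'a \<times> 'a \<Rightarrow> real" where
  "edge_energy \<mu> p f = (\<lambda>(x, y). \<mu> x y * \<bar>f x - f y\<bar> powr p)"

lemma nonneg_summable_on_bounded_sums:
  fixes f :: "'b \<Rightarrow> real"
  assumes "\<And>x. x \<in> A \<Longrightarrow> 0 \<le> f x" "\<And>F. finite F \<Longrightarrow> F \<subseteq> A \<Longrightarrow> sum f F \<le> c"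
  shows "f summable_on A" "infsum f A \<le> c"
proof -
  show "f summable_on A"
    using assms by (intro nonneg_bdd_above_summable_on bdd_aboveI[of _ c]) auto
  then show "infsum f A \<le> c" using assms(2) by (rule infsum_le_finite_sums)
qed

context weighted_graph
begin

lemma edge_energy_nonneg [simp]: "0 \<le> edge_energy \<mu> p f z"
  by (auto simp: edge_energy_def mu_nonneg split: prod.split)

lemma p_energy_eq_SUP:
  "p_energy \<mu> p W f
     = (SUP F\<in>{F. finite F \<and> F \<subseteq> W \<times> W}. ennreal (sum (edge_energy \<mu> p f) F)) / 2"
proof -
  have "(\<lambda>(x, y). ennreal (\<mu> x y * \<bar>f x - f y\<bar> powr p)) = (\<lambda>z. ennreal (edge_energy \<mu> p f z))"
    by (auto simp: edge_energy_def)
  then show ?thesis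
    unfolding p_energy_def by (simp add: nonneg_infsum_complete)
qed

lemma sum_edge_energy_le_p_energy:
  assumes "p_energy \<mu> p W f \<le> ennreal c" "0 \<le> c" "finite F" "F \<subseteq> W \<times> W"
  shows "sum (edge_energy \<mu> p f) F \<le> 2 * c"
proof -
  have "ennreal (sum (edge_energy \<mu> p f) F / 2) = ennreal (sum (edge_energy \<mu> p f) F) / 2"
    using divide_ennreal[of "sum (edge_energy \<mu> p f) F" 2] by (simp add: sum_nonneg)
  also have "\<dots> \<le> p_energy \<mu> p W f"
    unfolding p_energy_eq_SUP
    by (intro divide_right_mono_ennreal SUP_upper) (use assms in auto)
  also have "\<dots> \<le> ennreal c" by (rule assms(1))
  finally show ?thesis using assms(2) by simp
qed

lemma edge_energy_summable_on:
  assumes "p_energy \<mu> p W f < \<infinity>"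
  shows "edge_energy \<mu> p f summable_on W \<times> W"
proof -
  obtain c where "0 \<le> c" "p_energy \<mu> p W f = ennreal c"
    using assms by (cases "p_energy \<mu> p W f") auto
  then show ?thesis
    using sum_edge_energy_le_p_energy[of p W f c]
    by (intro nonneg_summable_on_bounded_sums(1)[of _ _ "2 * c"]) auto
qed

lemma p_energy_le:
  assumes "edge_energy \<mu> p f summable_on W \<times> W"
  shows "p_energy \<mu> p W f \<le> ennreal (infsum (edge_energy \<mu> p f) (W \<times> W) / 2)"
proof -
  have "p_energy \<mu> p W f \<le> ennreal (infsum (edge_energy \<mu> p f) (W \<times> W)) / 2"
    unfolding p_energy_eq_SUP
    by (intro divide_right_mono_ennreal SUP_least ennreal_leI finite_sum_le_infsum)
       (use assms in auto)
  also have "\<dots> = ennreal (infsum (edge_energy \<mu> p f) (W \<times> W) / 2)"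
    using divide_ennreal[of "infsum (edge_energy \<mu> p f) (W \<times> W)" 2] by (simp add: infsum_nonneg)
  finally show ?thesis .
qed

lemma edge_energy_limit:
  assumes "1 < p" "\<And>x. (\<lambda>n. g n x) \<longlonglongrightarrow> h x"
  shows "(\<lambda>n. edge_energy \<mu> p (g n) z) \<longlonglongrightarrow> edge_energy \<mu> p h z"
  unfolding edge_energy_def
  by (auto split: prod.split intro!: tendsto_mult tendsto_diff tendsto_abs_powr assms)

text \<open>
  Lower semicontinuity of the energy: for a finite set of pairs the sum is continuous under
  pointwise convergence, and the energy is the supremum of these sums.
\<close>

lemma fatou_edge_energy:
  assumes "1 < p" "\<And>x. (\<lambda>n. g n x) \<longlonglongrightarrow> h x"
    and "\<forall>\<^sub>F n in sequentially. edge_energy \<mu> p (g n) summable_on A \<and> infsum (edge_energy \<mu> p (g n)) A \<le> c"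
  shows "edge_energy \<mu> p h summable_on A" "infsum (edge_energy \<mu> p h) A \<le> c"
proof -
  have "sum (edge_energy \<mu> p h) F \<le> c" if F: "finite F" "F \<subseteq> A" for F
  proof (rule tendsto_upperbound)
    show "(\<lambda>n. sum (edge_energy \<mu> p (g n)) F) \<longlonglongrightarrow> sum (edge_energy \<mu> p h) F"
      by (intro tendsto_sum edge_energy_limit assms)
    show "\<forall>\<^sub>F n in sequentially. sum (edge_energy \<mu> p (g n)) F \<le> c"
      using assms(3)
    proof eventually_elim
      case (elim n)
      then show ?case
        using finite_sum_le_infsum[of "edge_energy \<mu> p (g n)" A F] F by auto
    qed
  qed simp
  then show "edge_energy \<mu> p h summable_on A" "infsum (edge_energy \<mu> p h) A \<le> c"
    using nonneg_summable_on_bounded_sums[of A "edge_energy \<mu> p h" c] by auto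
qed

lemma edge_energy_contraction:
  assumes "1 < p" "\<And>x y. \<bar>g x - g y\<bar> \<le> \<bar>f x - f y\<bar>" "edge_energy \<mu> p f summable_on A"
  shows "edge_energy \<mu> p g summable_on A"
    "infsum (edge_energy \<mu> p g) A \<le> infsum (edge_energy \<mu> p f) A"
proof -
  have le: "edge_energy \<mu> p g z \<le> edge_energy \<mu> p f z" for z
    using assms(1,2) by (auto simp: edge_energy_def mu_nonneg split: prod.split
        intro!: mult_left_mono powr_mono2)
  show *: "edge_energy \<mu> p g summable_on A"
    by (rule summable_on_comparison_test[OF assms(3)]) (use le in auto)
  show "infsum (edge_energy \<mu> p g) A \<le> infsum (edge_energy \<mu> p f) A"
    by (rule infsum_mono[OF * assms(3)]) (use le in auto)
qed

text \<open>
  The pointwise inequality \<open>abs_powr_uniformly_convex\<close>, summed over the edges. It is what turns a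
  nearly minimal energy of two functions and their midpoint into closeness.
\<close>

lemma energy_uniformly_convex:
  assumes p: "1 < p"
    and f: "edge_energy \<mu> p f summable_on A" and g: "edge_energy \<mu> p g summable_on A"
    and "0 \<le> C" "\<And>a b. \<bar>a - b\<bar> powr p + C * \<bar>(a + b) / 2\<bar> powr p \<le> (\<delta> + C / 2) * (\<bar>a\<bar> powr p + \<bar>b\<bar> powr p)"
  shows "edge_energy \<mu> p (\<lambda>x. (f x + g x) / 2) summable_on A"
    and "edge_energy \<mu> p (\<lambda>x. f x - g x) summable_on A"
    and "infsum (edge_energy \<mu> p (\<lambda>x. f x - g x)) A + C * infsum (edge_energy \<mu> p (\<lambda>x. (f x + g x) / 2)) A
      \<le> (\<delta> + C / 2) * (infsum (edge_energy \<mu> p f) A + infsum (edge_energy \<mu> p g) A)"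
proof -
  let ?e = "edge_energy \<mu> p"
  let ?m = "\<lambda>x. (f x + g x) / 2" and ?d = "\<lambda>x. f x - g x"
  have fg: "(\<lambda>z. ?e f z + ?e g z) summable_on A" by (intro summable_on_add f g)
  have mid: "?e ?m z \<le> ?e f z + ?e g z" for z
  proof -
    obtain x y where z: "z = (x, y)" by (cases z)
    have "?m x - ?m y = ((f x - f y) + (g x - g y)) / 2" by (simp add: field_simps)
    then have "\<bar>?m x - ?m y\<bar> powr p \<le> (\<bar>f x - f y\<bar> powr p + \<bar>g x - g y\<bar> powr p) / 2"
      by (simp only: abs_powr_midpoint_le[OF p])
    also have "\<dots> \<le> \<bar>f x - f y\<bar> powr p + \<bar>g x - g y\<bar> powr p" by simp
    finally have "\<bar>?m x - ?m y\<bar> powr p \<le> \<bar>f x - f y\<bar> powr p + \<bar>g x - g y\<bar> powr p" .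
    from mult_left_mono[OF this mu_nonneg[of x y]] show ?thesis
      by (simp add: z edge_energy_def algebra_simps)
  qed
  show m: "?e ?m summable_on A"
    by (rule summable_on_comparison_test[OF fg]) (use mid in auto)
  have conv: "?e ?d z + C * ?e ?m z \<le> (\<delta> + C / 2) * (?e f z + ?e g z)" for z
  proof -
    obtain x y where z: "z = (x, y)" by (cases z)
    have "?d x - ?d y = (f x - f y) - (g x - g y)" "?m x - ?m y = ((f x - f y) + (g x - g y)) / 2"
      by (simp_all add: field_simps)
    then have "\<bar>?d x - ?d y\<bar> powr p + C * \<bar>?m x - ?m y\<bar> powr p
        \<le> (\<delta> + C / 2) * (\<bar>f x - f y\<bar> powr p + \<bar>g x - g y\<bar> powr p)"
      by (simp only: assms(5))
    from mult_left_mono[OF this mu_nonneg[of x y]] show ?thesis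
      by (simp add: z edge_energy_def algebra_simps)
  qed
  have R: "(\<lambda>z. (\<delta> + C / 2) * (?e f z + ?e g z)) summable_on A"
    by (intro summable_on_cmult_right fg)
  show d: "?e ?d summable_on A"
  proof (rule summable_on_comparison_test[OF R])
    show "?e ?d z \<le> (\<delta> + C / 2) * (?e f z + ?e g z)" for z
      using conv[of z] mult_nonneg_nonneg[OF assms(4) edge_energy_nonneg[of p ?m z]] by linarith
  qed auto
  have Cm: "(\<lambda>z. C * ?e ?m z) summable_on A" by (intro summable_on_cmult_right m)
  have "infsum (?e ?d) A + C * infsum (?e ?m) A = infsum (\<lambda>z. ?e ?d z + C * ?e ?m z) A"
    using infsum_add[OF d Cm] infsum_cmult_right[of C "?e ?m" A] m by simp
  also have "\<dots> \<le> infsum (\<lambda>z. (\<delta> + C / 2) * (?e f z + ?e g z)) A"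
    using conv by (intro infsum_mono R summable_on_add d Cm)
  also have "\<dots> = (\<delta> + C / 2) * (infsum (?e f) A + infsum (?e g) A)"
    using infsum_cmult_right[of "\<delta> + C / 2" "\<lambda>z. ?e f z + ?e g z" A] infsum_add[OF f g] fg by simp
  finally show "infsum (?e ?d) A + C * infsum (?e ?m) A \<le> \<dots>" .
qed

text \<open>
  The terms that change belong to the edges at \<open>x\<close>, each met in both orientations. A loop at
  \<open>x\<close> has energy \<open>0\<close> before and after the change, so it is left out of the sum.
\<close>

lemma energy_vertex_update:
  assumes fin: "finite (E `` {x})" and g: "edge_energy \<mu> p g summable_on UNIV"
  shows "edge_energy \<mu> p (g(x := t)) summable_on UNIV"
    and "infsum (edge_energy \<mu> p (g(x := t))) UNIV = infsum (edge_energy \<mu> p g) UNIV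
      + 2 * (\<Sum>y\<in>E `` {x} - {x}. \<mu> x y * (\<bar>t - g y\<bar> powr p - \<bar>g x - g y\<bar> powr p))"
proof -
  let ?e = "edge_energy \<mu> p" and ?g = "g(x := t)" and ?S = "E `` {x} - {x}"
  let ?d = "\<lambda>z. ?e ?g z - ?e g z"
  let ?F = "{x} \<times> ?S" and ?G = "?S \<times> {x}"
  have fins: "finite ?F" "finite ?G" using fin by auto
  have zero: "\<mu> a b = 0" if "(a, b) \<notin> E" for a b
    using that mu_pos_iff[of a b] mu_nonneg[of a b] by linarith
  have "?d z = 0" if "z \<notin> ?F \<union> ?G" for z
    using that sym_E zero by (auto simp: edge_energy_def sym_def split: prod.split)
  then have "(?d has_sum sum ?d (?F \<union> ?G)) UNIV"
    using fins by (intro has_sum_finite_neutralI) auto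
  moreover have "sum ?d (?F \<union> ?G) = sum ?d ?F + sum ?d ?G"
    using fins by (intro sum.union_disjoint) auto
  moreover have Pair_x: "?F = Pair x ` ?S" "?G = (\<lambda>y. (y, x)) ` ?S" by auto
  moreover have "sum ?d ?F = (\<Sum>y\<in>?S. ?d (x, y))"
    by (simp add: Pair_x sum.reindex inj_on_def)
  moreover have "sum ?d ?G = (\<Sum>y\<in>?S. ?d (y, x))"
    by (simp add: Pair_x sum.reindex inj_on_def)
  moreover have "(\<Sum>y\<in>?S. ?d (x, y)) = (\<Sum>y\<in>?S. \<mu> x y * (\<bar>t - g y\<bar> powr p - \<bar>g x - g y\<bar> powr p))"
    by (intro sum.cong) (auto simp: edge_energy_def algebra_simps)
  moreover have "(\<Sum>y\<in>?S. ?d (y, x)) = (\<Sum>y\<in>?S. \<mu> x y * (\<bar>t - g y\<bar> powr p - \<bar>g x - g y\<bar> powr p))"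
    by (intro sum.cong) (auto simp: edge_energy_def mu_sym[of _ x] abs_minus_commute algebra_simps)
  ultimately have "(?d has_sum 2 * (\<Sum>y\<in>?S. \<mu> x y * (\<bar>t - g y\<bar> powr p - \<bar>g x - g y\<bar> powr p))) UNIV"
    by simp
  from has_sum_add[OF has_sum_infsum[OF g] this]
  have "(?e ?g has_sum (infsum (?e g) UNIV
      + 2 * (\<Sum>y\<in>?S. \<mu> x y * (\<bar>t - g y\<bar> powr p - \<bar>g x - g y\<bar> powr p)))) UNIV"
    by simp
  then show "?e ?g summable_on UNIV" "infsum (?e ?g) UNIV = infsum (?e g) UNIV
      + 2 * (\<Sum>y\<in>?S. \<mu> x y * (\<bar>t - g y\<bar> powr p - \<bar>g x - g y\<bar> powr p))"
    using has_sum_imp_summable infsumI by blast+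
qed

end

section \<open>P-harmonic functions and the maximum principle\<close>

locale p_network = weighted_graph E \<mu> for E :: "('a \<times> 'a) set" and \<mu> +
  fixes p :: real
  assumes p_gt_1: "1 < p"
    and locally_finite: "locally_finite_graph E"
    and connected: "connected_subgraph E UNIV"
begin

lemma p_pos: "0 < p"
  using p_gt_1 by simp

lemma finite_neighbours [simp]: "finite (E `` {x})"
  using locally_finite by (simp add: locally_finite_graph_def)

lemma mu_zero: "(x, y) \<notin> E \<Longrightarrow> \<mu> x y = 0"
  using mu_pos_iff[of x y] mu_nonneg[of x y] by linarith

lemma closed_under_neighbours_eq_UNIV:
  assumes "x \<in> S" "\<And>x y. x \<in> S \<Longrightarrow> (x, y) \<in> E \<Longrightarrow> y \<in> S"
  shows "S = UNIV"
proof -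
  have "y \<in> S" for y
  proof -
    have "(x, y) \<in> E\<^sup>*" using connected by (auto simp: connected_subgraph_def)
    then show ?thesis by (induction rule: rtrancl_induct) (use assms in auto)
  qed
  then show ?thesis by auto
qed

definition flux :: "('a \<Rightarrow> real) \<Rightarrow> 'a \<Rightarrow> 'a \<Rightarrow> real" where
  "flux u x y = \<mu> x y * \<bar>u y - u x\<bar> powr (p - 2) * (u y - u x)"

lemma p_laplacian_eq_0_iff: "p_laplacian E \<mu> p u x = 0 \<longleftrightarrow> (\<Sum>y\<in>E `` {x}. flux u x y) = 0"
proof (cases "E `` {x} = {}")
  case True
  then show ?thesis by (simp add: p_laplacian_def)
next
  case False
  then have "vertex_measure E \<mu> x > 0"
    unfolding vertex_measure_def using mu_pos_iff by (intro sum_pos) auto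
  then show ?thesis by (simp add: p_laplacian_def flux_def)
qed

lemma p_laplacian_one_minus_eq_0_iff:
  "p_laplacian E \<mu> p (\<lambda>x. 1 - u x) x = 0 \<longleftrightarrow> p_laplacian E \<mu> p u x = 0"
proof -
  have "flux (\<lambda>x. 1 - u x) x y = - flux u x y" for y
    by (simp add: flux_def abs_minus_commute algebra_simps)
  then show ?thesis by (simp add: p_laplacian_eq_0_iff sum_negf)
qed

text \<open>
  Strong maximum principle at one vertex: the flux to every neighbour is nonpositive, and the
  fluxes add up to \<open>0\<close>.
\<close>

lemma p_harmonic_local_max:
  assumes "p_laplacian E \<mu> p u x = 0" "\<And>y. (x, y) \<in> E \<Longrightarrow> u y \<le> u x" "(x, y) \<in> E"
  shows "u y = u x"
proof -
  have nonneg: "0 \<le> - flux u x y" if "y \<in> E `` {x}" for y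
  proof -
    have "flux u x y \<le> 0" unfolding flux_def
      using that assms(2)[of y] mu_nonneg[of x y] by (intro mult_nonneg_nonpos) auto
    then show ?thesis by simp
  qed
  have "(\<Sum>y\<in>E `` {x}. - flux u x y) = 0"
    using assms(1) by (simp add: p_laplacian_eq_0_iff sum_negf)
  then have "flux u x y = 0"
    using sum_nonneg_eq_0_iff[OF finite_neighbours[of x] nonneg] assms(3) by auto
  moreover have "\<mu> x y > 0" using assms(3) mu_pos_iff by simp
  ultimately show ?thesis by (auto simp: flux_def)
qed

text \<open>
  The Euler-Lagrange equation. The p-Laplacian at \<open>x\<close> is, up to a constant, the derivative of the
  energy with respect to the value at \<open>x\<close>.
\<close>

lemma p_harmonic_if_vertex_minimal:
  assumes "\<And>t. 0 \<le> (\<Sum>y\<in>E `` {x} - {x}. \<mu> x y * (\<bar>t - v y\<bar> powr p - \<bar>v x - v y\<bar> powr p))"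
  shows "p_laplacian E \<mu> p v x = 0"
proof -
  let ?S = "E `` {x} - {x}"
  let ?h = "\<lambda>t. \<Sum>y\<in>?S. \<mu> x y * (\<bar>t - v y\<bar> powr p - \<bar>v x - v y\<bar> powr p)"
  have deriv: "(?h has_real_derivative
      (\<Sum>y\<in>?S. \<mu> x y * (p * (\<bar>v x - v y\<bar> powr (p - 2) * (v x - v y))))) (at (v x))"
  proof (intro DERIV_sum DERIV_cmult)
    fix y
    have "((\<lambda>t. t - v y) has_real_derivative 1) (at (v x))"
      by (auto intro!: derivative_eq_intros)
    from DERIV_chain2[OF has_real_derivative_abs_powr[OF p_gt_1] this]
    have "((\<lambda>t. \<bar>t - v y\<bar> powr p) has_real_derivative
        p * (\<bar>v x - v y\<bar> powr (p - 2) * (v x - v y))) (at (v x))" by simp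
    from DERIV_diff[OF this DERIV_const]
    show "((\<lambda>t. \<bar>t - v y\<bar> powr p - \<bar>v x - v y\<bar> powr p) has_real_derivative
        p * (\<bar>v x - v y\<bar> powr (p - 2) * (v x - v y))) (at (v x))" by simp
  qed
  have "(\<Sum>y\<in>?S. \<mu> x y * (p * (\<bar>v x - v y\<bar> powr (p - 2) * (v x - v y)))) = 0"
    by (rule DERIV_local_min[OF deriv, of 1]) (use assms in auto)
  also have "(\<Sum>y\<in>?S. \<mu> x y * (p * (\<bar>v x - v y\<bar> powr (p - 2) * (v x - v y))))
      = - p * (\<Sum>y\<in>?S. flux v x y)"
    unfolding sum_distrib_left
    by (intro sum.cong) (auto simp: flux_def abs_minus_commute algebra_simps)
  also have "(\<Sum>y\<in>?S. flux v x y) = (\<Sum>y\<in>E `` {x}. flux v x y)"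
    by (rule sum.mono_neutral_left) (auto simp: flux_def)
  finally show ?thesis using p_gt_1 by (simp add: p_laplacian_eq_0_iff)
qed

section \<open>Minimizing the energy\<close>

text \<open>
  The class in which the energy is minimized. Boundary values on \<open>- \<Omega>\<close> and the values near
  infinity are both prescribed by \<open>f\<close>; that the latter leave a trace in the limit is what
  non-parabolicity of \<open>\<Omega>1\<close> ensures later.
\<close>

definition finite_perturbations :: "('a \<Rightarrow> real) \<Rightarrow> 'a set \<Rightarrow> ('a \<Rightarrow> real) set" where
  "finite_perturbations f \<Omega> = {g. edge_energy \<mu> p g summable_on UNIV \<and>
     finite {x. g x \<noteq> f x} \<and> {x. g x \<noteq> f x} \<subseteq> \<Omega>}"

text \<open>
  The energy of \<open>g i - g j\<close> bounds its difference along every single edge, so convergence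
  propagates from \<open>a\<close> along paths.
\<close>

lemma pointwise_convergent_if_energy_Cauchy:
  fixes g :: "nat \<Rightarrow> 'a \<Rightarrow> real"
  assumes "\<And>i j. edge_energy \<mu> p (\<lambda>x. g i x - g j x) summable_on UNIV"
    and cauchy: "\<And>e. 0 < e \<Longrightarrow> \<exists>N. \<forall>i\<ge>N. \<forall>j\<ge>N. infsum (edge_energy \<mu> p (\<lambda>x. g i x - g j x)) UNIV \<le> e"
    and "convergent (\<lambda>n. g n a)"
  shows "convergent (\<lambda>n. g n x)"
proof -
  let ?C = "{x. convergent (\<lambda>n. g n x)}"
  have step: "y \<in> ?C" if "x \<in> ?C" "(x, y) \<in> E" for x y
  proof -
    have pos: "\<mu> x y > 0" using that mu_pos_iff by simp
    have "Cauchy (\<lambda>n. g n x - g n y)"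
    proof (rule metric_CauchyI)
      fix r :: real assume "0 < r"
      define e where "e = \<mu> x y * (r / 2) powr p"
      have "e > 0" using \<open>0 < r\<close> pos by (simp add: e_def)
      from cauchy[OF this] obtain N where
        N: "\<And>i j. i \<ge> N \<Longrightarrow> j \<ge> N \<Longrightarrow> infsum (edge_energy \<mu> p (\<lambda>x. g i x - g j x)) UNIV \<le> e" by blast
      have "dist (g i x - g i y) (g j x - g j y) < r" if "i \<ge> N" "j \<ge> N" for i j
      proof -
        have "sum (edge_energy \<mu> p (\<lambda>x. g i x - g j x)) {(x, y)} \<le> e"
          using finite_sum_le_infsum[OF assms(1)[of i j], of "{(x, y)}"] N[OF that] by simp
        then have "\<bar>(g i x - g j x) - (g i y - g j y)\<bar> powr p \<le> (r / 2) powr p"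
          using pos by (simp add: edge_energy_def e_def)
        then have "\<bar>(g i x - g j x) - (g i y - g j y)\<bar> \<le> r / 2"
          using \<open>0 < r\<close> p_pos by (smt (verit) powr_less_mono2 half_gt_zero)
        moreover have "(g i x - g i y) - (g j x - g j y) = (g i x - g j x) - (g i y - g j y)"
          by simp
        ultimately show ?thesis using \<open>0 < r\<close> unfolding dist_real_def by linarith
      qed
      then show "\<exists>M. \<forall>m\<ge>M. \<forall>n\<ge>M. dist (g m x - g m y) (g n x - g n y) < r" by blast
    qed
    then have "convergent (\<lambda>n. g n x - g n y)" by (rule Cauchy_convergent)
    from convergent_diff[OF _ this] that(1) show ?thesis by fastforce
  qed
  have "?C = UNIV"
    by (rule closed_under_neighbours_eq_UNIV[of a]) (use assms(3) step in blast)+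
  then show ?thesis by blast
qed

text \<open>
  Cutting a function off to \<open>[0, 1]\<close> lowers its energy, and it preserves the class because \<open>f\<close>
  takes values in \<open>[0, 1]\<close>.
\<close>

lemma minimizing_sequence:
  assumes "f \<in> finite_perturbations f \<Omega>" "\<And>x. 0 \<le> f x" "\<And>x. f x \<le> 1"
  obtains g :: "nat \<Rightarrow> 'a \<Rightarrow> real" and m where
    "\<And>n. g n \<in> finite_perturbations f \<Omega>" "\<And>n x. 0 \<le> g n x" "\<And>n x. g n x \<le> 1"
    "\<And>h. h \<in> finite_perturbations f \<Omega> \<Longrightarrow> m \<le> infsum (edge_energy \<mu> p h) UNIV"
    "\<And>n. infsum (edge_energy \<mu> p (g n)) UNIV \<le> m + 1 / real (Suc n)" "0 \<le> m"
proof -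
  let ?D = "\<lambda>h. infsum (edge_energy \<mu> p h) UNIV"
  let ?A = "finite_perturbations f \<Omega>"
  define m where "m = Inf (?D ` ?A)"
  have bdd: "bdd_below (?D ` ?A)" by (rule bdd_belowI[of _ 0]) (auto intro: infsum_nonneg)
  have lower: "m \<le> ?D h" if "h \<in> ?A" for h
    unfolding m_def using bdd that by (intro cInf_lower) auto
  have "0 \<le> m" unfolding m_def using assms(1) by (intro cInf_greatest) (auto intro: infsum_nonneg)
  have "\<exists>g\<in>?A. (\<forall>x. 0 \<le> g x \<and> g x \<le> 1) \<and> ?D g \<le> m + 1 / real (Suc n)" for n
  proof -
    have "Inf (?D ` ?A) < m + 1 / real (Suc n)" by (simp add: m_def)
    then obtain h where h: "h \<in> ?A" "?D h < m + 1 / real (Suc n)"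
      using assms(1) bdd by (subst (asm) cInf_less_iff) auto
    define g where "g = (\<lambda>x. max 0 (min 1 (h x)))"
    have contr: "\<bar>g x - g y\<bar> \<le> \<bar>h x - h y\<bar>" for x y by (auto simp: g_def max_def min_def)
    note g = edge_energy_contraction[where A = UNIV and f = h and g = g, OF p_gt_1 contr]
    have "g x = f x" if "h x = f x" for x
      using that assms(2,3)[of x] by (simp add: g_def min_absorb2 max_absorb2)
    then have sub: "{x. g x \<noteq> f x} \<subseteq> {x. h x \<noteq> f x}" by auto
    have "finite {x. g x \<noteq> f x}" "{x. g x \<noteq> f x} \<subseteq> \<Omega>"
      using h(1) finite_subset[OF sub] sub by (auto simp: finite_perturbations_def)
    moreover have "edge_energy \<mu> p g summable_on UNIV" "?D g \<le> ?D h"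
      using g h(1) by (auto simp: finite_perturbations_def)
    ultimately show ?thesis using h(2)
      by (intro bexI[of _ g]) (auto simp: finite_perturbations_def g_def)
  qed
  then obtain g where "\<And>n. g n \<in> ?A \<and> (\<forall>x. 0 \<le> g n x \<and> g n x \<le> 1) \<and> ?D (g n) \<le> m + 1 / real (Suc n)"
    by metis
  then show ?thesis using that[of g m] lower \<open>0 \<le> m\<close> by blast
qed

text \<open>
  The midpoint of \<open>g i\<close> and \<open>g j\<close> belongs to the class, so its energy is at least \<open>m\<close>. Uniform
  convexity then bounds the energy of \<open>g i - g j\<close> by a small multiple of a bounded quantity plus
  a constant times the excess of the energies over \<open>m\<close>.
\<close>

lemma minimizing_sequence_Cauchy:
  assumes g: "\<And>n. g n \<in> finite_perturbations f \<Omega>"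
    and lower: "\<And>h. h \<in> finite_perturbations f \<Omega> \<Longrightarrow> m \<le> infsum (edge_energy \<mu> p h) UNIV"
    and upper: "\<And>n. infsum (edge_energy \<mu> p (g n)) UNIV \<le> m + 1 / real (Suc n)"
    and "0 \<le> m"
  shows "edge_energy \<mu> p (\<lambda>x. g i x - g j x) summable_on UNIV"
    and "0 < e \<Longrightarrow> \<exists>N. \<forall>i\<ge>N. \<forall>j\<ge>N. infsum (edge_energy \<mu> p (\<lambda>x. g i x - g j x)) UNIV \<le> e"
proof -
  let ?D = "\<lambda>h. infsum (edge_energy \<mu> p h) UNIV"
  have summable: "edge_energy \<mu> p (g n) summable_on UNIV" for n
    using g[of n] by (simp add: finite_perturbations_def)
  have convex: "edge_energy \<mu> p (\<lambda>x. g i x - g j x) summable_on UNIV \<and>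
      ?D (\<lambda>x. g i x - g j x) \<le> \<delta> * (?D (g i) + ?D (g j)) + C * ((?D (g i) + ?D (g j)) / 2 - m)"
    if "0 \<le> C" "\<And>a b. \<bar>a - b\<bar> powr p + C * \<bar>(a + b) / 2\<bar> powr p \<le> (\<delta> + C / 2) * (\<bar>a\<bar> powr p + \<bar>b\<bar> powr p)"
    for i j \<delta> C
  proof -
    note uc = energy_uniformly_convex[OF p_gt_1 summable[of i] summable[of j] that]
    have "{x. (g i x + g j x) / 2 \<noteq> f x} \<subseteq> {x. g i x \<noteq> f x} \<union> {x. g j x \<noteq> f x}" by auto
    then have "(\<lambda>x. (g i x + g j x) / 2) \<in> finite_perturbations f \<Omega>"
      using g[of i] g[of j] uc(1) unfolding finite_perturbations_def
      by (auto intro: finite_subset)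
    from mult_left_mono[OF lower[OF this] that(1)]
    have "?D (\<lambda>x. g i x - g j x) + C * m \<le> (\<delta> + C / 2) * (?D (g i) + ?D (g j))"
      using uc(3) by linarith
    also have "\<dots> = \<delta> * (?D (g i) + ?D (g j)) + C * ((?D (g i) + ?D (g j)) / 2 - m) + C * m"
      by (simp add: field_simps)
    finally show ?thesis using uc(2) by simp
  qed
  show "edge_energy \<mu> p (\<lambda>x. g i x - g j x) summable_on UNIV"
  proof -
    obtain C where C: "0 < C"
      "\<And>a b. \<bar>a - b\<bar> powr p + C * \<bar>(a + b) / 2\<bar> powr p \<le> (1 + C / 2) * (\<bar>a\<bar> powr p + \<bar>b\<bar> powr p)"
      using abs_powr_uniformly_convex[OF p_gt_1, of 1] by auto
    then show ?thesis using convex[OF less_imp_le[OF C(1)] C(2)] by blast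
  qed
  assume e: "0 < e"
  \<comment> \<open>The energies are at most \<open>m + 1\<close>, so the term with \<open>\<delta>\<close> contributes at most \<open>e / 2\<close>.\<close>
  define \<delta> where "\<delta> = e / (4 * (m + 1))"
  have "0 < \<delta>" using e \<open>0 \<le> m\<close> by (simp add: \<delta>_def)
  from abs_powr_uniformly_convex[OF p_gt_1 this] obtain C where C: "0 < C"
    "\<And>a b. \<bar>a - b\<bar> powr p + C * \<bar>(a + b) / 2\<bar> powr p \<le> (\<delta> + C / 2) * (\<bar>a\<bar> powr p + \<bar>b\<bar> powr p)" by blast
  obtain N where N: "1 / real (Suc N) < e / (2 * C)"
    using reals_Archimedean[of "e / (2 * C)"] e C(1) by (auto simp: inverse_eq_divide)
  have "?D (\<lambda>x. g i x - g j x) \<le> e" if "i \<ge> N" "j \<ge> N" for i j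
  proof -
    have b: "?D (g n) \<le> m + e / (2 * C) \<and> ?D (g n) \<le> m + 1" if "n \<ge> N" for n
    proof -
      have "1 / real (Suc n) \<le> 1 / real (Suc N)" "1 / real (Suc n) \<le> 1"
        using that by (simp_all add: frac_le)
      then show ?thesis using upper[of n] N by linarith
    qed
    have "\<delta> * (?D (g i) + ?D (g j)) \<le> \<delta> * (2 * (m + 1))"
      using b[OF \<open>i \<ge> N\<close>] b[OF \<open>j \<ge> N\<close>] \<open>0 < \<delta>\<close> by (intro mult_left_mono) auto
    also have "\<dots> = e / 2"
    proof -
      have "e / (4 * M) * (2 * M) = e / 2" if "0 < M" for M :: real using that by simp
      from this[of "m + 1"] show ?thesis using \<open>0 \<le> m\<close> unfolding \<delta>_def by linarith
    qed
    finally have 1: "\<delta> * (?D (g i) + ?D (g j)) \<le> e / 2" .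
    have "(a + b) / 2 - m \<le> q" if "a \<le> m + q" "b \<le> m + q" for a b q :: real
      using that by (simp add: field_simps)
    from this[OF b[OF \<open>i \<ge> N\<close>, THEN conjunct1] b[OF \<open>j \<ge> N\<close>, THEN conjunct1]]
    have "C * ((?D (g i) + ?D (g j)) / 2 - m) \<le> C * (e / (2 * C))"
      by (rule mult_left_mono) (use C(1) in simp)
    also have "\<dots> = e / 2" using C(1) by simp
    finally have 2: "C * ((?D (g i) + ?D (g j)) / 2 - m) \<le> e / 2" .
    show ?thesis using convex[OF less_imp_le[OF C(1)] C(2), of i j] 1 2 by linarith
  qed
  then show "\<exists>N. \<forall>i\<ge>N. \<forall>j\<ge>N. ?D (\<lambda>x. g i x - g j x) \<le> e" by blast
qed

text \<open>
  Changing \<open>g n\<close> at \<open>x\<close> lowers its energy by at most the excess \<open>1 / Suc n\<close> over the infimum. The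
  change of energy is a finite sum, so it passes to the pointwise limit.
\<close>

lemma limit_of_minimizing_sequence_harmonic:
  assumes g: "\<And>n. g n \<in> finite_perturbations f \<Omega>"
    and lower: "\<And>h. h \<in> finite_perturbations f \<Omega> \<Longrightarrow> m \<le> infsum (edge_energy \<mu> p h) UNIV"
    and upper: "\<And>n. infsum (edge_energy \<mu> p (g n)) UNIV \<le> m + 1 / real (Suc n)"
    and lim: "\<And>x. (\<lambda>n. g n x) \<longlonglongrightarrow> v x"
    and x: "x \<in> \<Omega>"
  shows "p_laplacian E \<mu> p v x = 0"
proof (rule p_harmonic_if_vertex_minimal)
  fix t
  let ?D = "\<lambda>h. infsum (edge_energy \<mu> p h) UNIV"
  let ?h = "\<lambda>u. \<Sum>y\<in>E `` {x} - {x}. \<mu> x y * (\<bar>t - u y\<bar> powr p - \<bar>u x - u y\<bar> powr p)"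
  have "- (1 / real (Suc n)) / 2 \<le> ?h (g n)" for n
  proof -
    have s: "edge_energy \<mu> p (g n) summable_on UNIV" using g[of n] by (simp add: finite_perturbations_def)
    note up = energy_vertex_update[OF finite_neighbours s, of x t]
    have sub: "{y. ((g n)(x := t)) y \<noteq> f y} \<subseteq> insert x {y. g n y \<noteq> f y}" by auto
    then have "(g n)(x := t) \<in> finite_perturbations f \<Omega>"
      using g[of n] up(1) x finite_subset[OF sub] unfolding finite_perturbations_def by auto
    note le = lower[OF this]
    have "- q / 2 \<le> S" if "m \<le> D'" "D' = D + 2 * S" "D \<le> m + q" for D D' S q :: real
      using that by linarith
    from this[OF le up(2) upper] show ?thesis .
  qed
  moreover have "(\<lambda>n. ?h (g n)) \<longlonglongrightarrow> ?h v"
    by (intro tendsto_sum tendsto_mult tendsto_diff tendsto_const tendsto_abs_powr p_gt_1 lim)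
  moreover have "(\<lambda>n. - (1 / real (Suc n)) / 2) \<longlonglongrightarrow> 0"
    using tendsto_mult[OF LIMSEQ_inverse_real_of_nat, of "\<lambda>_. - 1 / 2" "- 1 / 2"]
    by (simp add: inverse_eq_divide)
  ultimately show "0 \<le> ?h v"
    by (intro LIMSEQ_le[of "\<lambda>n. - (1 / real (Suc n)) / 2" 0]) auto
qed

section \<open>Massive sets from non-parabolic sets of finite capacity\<close>

text \<open>
  The test function is \<open>min 1 (2 * (1 - g))\<close>. The factor \<open>2\<close> makes it equal to \<open>1\<close> on \<open>K\<close>, where
  \<open>g\<close> is merely small.
\<close>

lemma infinity_conductance_le:
  assumes "edge_energy \<mu> p g summable_on UNIV" "finite {x \<in> W. g x \<noteq> 1}" "\<And>x. x \<in> K \<Longrightarrow> g x \<le> 1 / 2"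
  shows "p_conductance_to_infinity \<mu> p K W
    \<le> ennreal (2 powr p * (infsum (edge_energy \<mu> p g) UNIV / 2))"
proof -
  define h where "h = (\<lambda>x. min 1 (2 * (1 - g x)))"
  have "{x \<in> W. h x \<noteq> 0} \<subseteq> {x \<in> W. g x \<noteq> 1}" by (auto simp: h_def)
  then have "finite {x \<in> W. h x \<noteq> 0}" using assms(2) finite_subset by blast
  moreover have "\<forall>x\<in>K. h x = 1" using assms(3) by (force simp: h_def)
  ultimately have "p_conductance_to_infinity \<mu> p K W \<le> p_energy \<mu> p W h"
    unfolding p_conductance_to_infinity_def by (intro Inf_lower) blast
  also have "\<dots> \<le> ennreal (2 powr p) * p_energy \<mu> p W g"
    by (rule p_energy_contraction) (use p_pos in \<open>auto simp: h_def min_def abs_if\<close>)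
  also have "\<dots> \<le> ennreal (2 powr p) * ennreal (infsum (edge_energy \<mu> p g) UNIV / 2)"
  proof (intro mult_left_mono)
    have W: "edge_energy \<mu> p g summable_on W \<times> W"
      by (rule summable_on_subset_banach[OF assms(1)]) auto
    have "infsum (edge_energy \<mu> p g) (W \<times> W) \<le> infsum (edge_energy \<mu> p g) UNIV"
      by (rule infsum_mono_neutral[OF W assms(1)]) auto
    then show "p_energy \<mu> p W g \<le> ennreal (infsum (edge_energy \<mu> p g) UNIV / 2)"
      by (intro order.trans[OF p_energy_le[OF W]] ennreal_leI) auto
  qed simp
  also have "\<dots> = ennreal (2 powr p * (infsum (edge_energy \<mu> p g) UNIV / 2))"
    by (subst ennreal_mult) (simp_all add: infsum_nonneg)
  finally show ?thesis .
qed

lemma p_conductance_finite_obtains: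
  assumes "p_conductance \<mu> p B1 B2 UNIV < \<infinity>"
  obtains f where "edge_energy \<mu> p f summable_on UNIV" "\<And>x. 0 \<le> f x" "\<And>x. f x \<le> 1"
    "\<And>x. x \<in> B1 \<Longrightarrow> f x = 1" "\<And>x. x \<in> B2 \<Longrightarrow> f x = 0"
proof -
  obtain h where h: "\<forall>x\<in>B1. h x = 1" "\<forall>x\<in>B2. h x = 0" "p_energy \<mu> p UNIV h < \<infinity>"
    using assms unfolding p_conductance_def Inf_less_iff by auto
  define f where "f = (\<lambda>x. max 0 (min 1 (h x)))"
  have contr: "\<bar>f x - f y\<bar> \<le> \<bar>h x - h y\<bar>" for x y by (auto simp: f_def max_def min_def)
  have "edge_energy \<mu> p h summable_on UNIV" using edge_energy_summable_on[OF h(3)] by simp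
  then have "edge_energy \<mu> p f summable_on UNIV"
    using edge_energy_contraction(1)[where f = h and g = f and A = UNIV, OF p_gt_1 contr] by blast
  then show ?thesis by (rule that) (use h in \<open>auto simp: f_def\<close>)
qed

text \<open>
  The minimizer \<open>v\<close> of the energy with the boundary values of a capacity test function is a
  nontrivial p-harmonic function on \<open>\<Omega>\<close>, and \<open>1 - v\<close> has the required properties. Connectedness of
  \<open>\<Omega>\<close> excludes that \<open>v\<close> vanishes on a part of \<open>\<Omega>\<close> that is separated from \<open>\<Omega>1\<close>.
\<close>

lemma massive_if_nonparabolic_finite_capacity:
  assumes \<Omega>: "connected_subgraph E \<Omega>" "- \<Omega> \<noteq> {}"
    and \<Omega>1: "\<Omega>1 \<subseteq> \<Omega>" "\<not> p_parabolic \<mu> p \<Omega>1" "p_capacity \<mu> p \<Omega>1 \<Omega> < \<infinity>"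
  shows "Dp_massive E \<mu> p \<Omega>"
proof -
  let ?D = "\<lambda>h. infsum (edge_energy \<mu> p h) UNIV"
  obtain K where K: "finite K" "K \<subseteq> \<Omega>1" "p_conductance_to_infinity \<mu> p K \<Omega>1 \<noteq> 0"
    using \<Omega>1(2) by (auto simp: p_parabolic_def)
  obtain z0 where z0: "z0 \<notin> \<Omega>" using \<Omega>(2) by blast
  obtain f where f: "edge_energy \<mu> p f summable_on UNIV" "\<And>x. 0 \<le> f x" "\<And>x. f x \<le> 1"
    "\<And>x. x \<in> \<Omega>1 \<Longrightarrow> f x = 1" "\<And>x. x \<in> - \<Omega> \<Longrightarrow> f x = 0"
    using p_conductance_finite_obtains[OF \<Omega>1(3)[unfolded p_capacity_def]] by blast
  have "f \<in> finite_perturbations f \<Omega>" using f(1) by (simp add: finite_perturbations_def)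
  from minimizing_sequence[OF this f(2,3)] obtain g :: "nat \<Rightarrow> 'a \<Rightarrow> real" and m where
    g: "\<And>n. g n \<in> finite_perturbations f \<Omega>" and g01: "\<And>n x. 0 \<le> g n x" "\<And>n x. g n x \<le> 1"
    and lower: "\<And>h. h \<in> finite_perturbations f \<Omega> \<Longrightarrow> m \<le> ?D h"
    and upper: "\<And>n. ?D (g n) \<le> m + 1 / real (Suc n)" and "0 \<le> m"
    by metis
  have cauchy: "edge_energy \<mu> p (\<lambda>x. g i x - g j x) summable_on UNIV"
    "0 < e \<Longrightarrow> \<exists>N. \<forall>i\<ge>N. \<forall>j\<ge>N. ?D (\<lambda>x. g i x - g j x) \<le> e" for i j e
    using minimizing_sequence_Cauchy[of g f \<Omega> m] g lower upper \<open>0 \<le> m\<close> by blast+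
  have summable: "edge_energy \<mu> p (g n) summable_on UNIV" for n
    using g[of n] by (simp add: finite_perturbations_def)
  have g_out: "g n x = 0" if "x \<notin> \<Omega>" for n x
  proof -
    have "g n x = f x" using g[of n] that unfolding finite_perturbations_def by blast
    then show ?thesis using f(5)[of x] that by simp
  qed
  have "convergent (\<lambda>n. g n x)" for x
    by (rule pointwise_convergent_if_energy_Cauchy[of g z0, OF cauchy])
       (auto simp: g_out[OF z0] convergent_const)
  then obtain v where v: "\<And>x. (\<lambda>n. g n x) \<longlonglongrightarrow> v x"
    unfolding convergent_def by metis
  have harmonic: "p_laplacian E \<mu> p v x = 0" if "x \<in> \<Omega>" for x
    using limit_of_minimizing_sequence_harmonic[OF g lower upper v that] by blast
  have v_out: "v x = 0" if "x \<notin> \<Omega>" for x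
    using LIMSEQ_unique[OF v[of x]] g_out[OF that] by simp
  have v_nonneg: "0 \<le> v x" and v_le_1: "v x \<le> 1" for x
    using LIMSEQ_le_const[OF v[of x], of 0] LIMSEQ_le_const2[OF v[of x], of 1] g01 by auto
  have "1 / real (Suc n) \<le> 1" for n by simp
  with upper have "?D (g n) \<le> m + 1" for n by (smt (verit))
  then have finite_energy: "edge_energy \<mu> p v summable_on UNIV"
    by (intro fatou_edge_energy(1)[OF p_gt_1 v, where A = UNIV and c = "m + 1"]) (use summable in auto)
  have v_nonzero: "\<exists>x\<in>\<Omega>. v x \<noteq> 0"
  proof (rule ccontr)
    assume "\<not> ?thesis"
    then have zero: "v x = 0" for x using v_out by (cases "x \<in> \<Omega>") auto
    have small: "p_conductance_to_infinity \<mu> p K \<Omega>1 \<le> ennreal e" if "0 < e" for e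
    proof -
      define d where "d = 2 * e / 2 powr p"
      have "0 < d" using that by (simp add: d_def)
      from cauchy(2)[OF this] obtain N where
        N: "\<And>i j. i \<ge> N \<Longrightarrow> j \<ge> N \<Longrightarrow> ?D (\<lambda>x. g i x - g j x) \<le> d" by blast
      \<comment> \<open>As the limit is \<open>0\<close>, the differences \<open>g i - g j\<close> tend to \<open>g i\<close>, and the Cauchy bound passes to \<open>g i\<close>.\<close>
      have D: "?D (g i) \<le> d" if "i \<ge> N" for i
      proof (rule fatou_edge_energy(2)[OF p_gt_1])
        show "(\<lambda>j. g i x - g j x) \<longlonglongrightarrow> g i x" for x
          using tendsto_diff[OF tendsto_const v[of x]] zero by simp
        show "\<forall>\<^sub>F j in sequentially. edge_energy \<mu> p (\<lambda>x. g i x - g j x) summable_on UNIV \<and>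
            ?D (\<lambda>x. g i x - g j x) \<le> d"
          using eventually_ge_at_top[of N] by eventually_elim (use N that cauchy(1) in auto)
      qed
      have "\<forall>\<^sub>F n in sequentially. \<forall>x\<in>K. g n x < 1 / 2"
        using K(1) v zero by (intro eventually_ball_finite ballI order_tendstoD(2)) auto
      then obtain n where n: "n \<ge> N" "\<forall>x\<in>K. g n x < 1 / 2"
        using eventually_conj[OF eventually_ge_at_top[of N]] eventually_happens by force
      have "{x \<in> \<Omega>1. g n x \<noteq> 1} \<subseteq> {x. g n x \<noteq> f x}" using f(4) by auto
      then have "finite {x \<in> \<Omega>1. g n x \<noteq> 1}"
        using g[of n] finite_subset by (auto simp: finite_perturbations_def)
      from infinity_conductance_le[OF summable this] n
      have "p_conductance_to_infinity \<mu> p K \<Omega>1 \<le> ennreal (2 powr p * (?D (g n) / 2))"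
        by (simp add: less_imp_le)
      also have "\<dots> \<le> ennreal (2 powr p * (d / 2))"
        using D[OF n(1)] by (intro ennreal_leI mult_left_mono) auto
      finally show ?thesis by (simp add: d_def)
    qed
    have "p_conductance_to_infinity \<mu> p K \<Omega>1 \<le> 0"
    proof (rule ennreal_le_epsilon)
      show "p_conductance_to_infinity \<mu> p K \<Omega>1 \<le> 0 + ennreal e" if "0 < e" for e
        using small[OF that] by simp
    qed
    then show False using K(3) by simp
  qed
  have v_pos: "0 < v x" if "x \<in> \<Omega>" for x
  proof (rule ccontr)
    assume "\<not> 0 < v x"
    then have "v x = 0" using v_nonneg[of x] by simp
    have step: "v b = 0" if "v a = 0" "a \<in> \<Omega>" "(a, b) \<in> E" for a b
      using p_harmonic_local_max[of "\<lambda>x. 1 - v x" a b] harmonic[OF that(2)] that v_nonneg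
      by (simp add: p_laplacian_one_minus_eq_0_iff)
    have "v y = 0" if "y \<in> \<Omega>" for y
    proof -
      have "(x, y) \<in> (E \<inter> \<Omega> \<times> \<Omega>)\<^sup>*"
        using \<Omega>(1) \<open>x \<in> \<Omega>\<close> that by (auto simp: connected_subgraph_def)
      then show ?thesis
        by (induction rule: rtrancl_induct) (use \<open>v x = 0\<close> step in auto)
    qed
    then show False using v_nonzero by blast
  qed
  have v_less_1: "v x < 1" for x
  proof (rule ccontr)
    assume "\<not> v x < 1"
    then have "v x = 1" using v_le_1[of x] by simp
    have step: "b \<in> {x. v x = 1}" if "a \<in> {x. v x = 1}" "(a, b) \<in> E" for a b
    proof -
      have "a \<in> \<Omega>" using that v_out[of a] by (cases "a \<in> \<Omega>") auto
      from p_harmonic_local_max[OF harmonic[OF this], of b] that v_le_1 show ?thesis by auto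
    qed
    have "{x. v x = 1} = UNIV"
      by (rule closed_under_neighbours_eq_UNIV[of x]) (use \<open>v x = 1\<close> step in blast)+
    then show False using v_out[OF z0] by (metis UNIV_I mem_Collect_eq zero_neq_one)
  qed
  have "p_energy \<mu> p UNIV (\<lambda>x. 1 - v x) < \<infinity>"
  proof -
    have "edge_energy \<mu> p (\<lambda>x. 1 - v x) summable_on UNIV \<times> UNIV"
      using edge_energy_contraction(1)[OF p_gt_1 _ finite_energy, of "\<lambda>x. 1 - v x"] by simp
    from p_energy_le[OF this] show ?thesis using le_less_trans by fastforce
  qed
  then show ?thesis
    unfolding Dp_massive_def using v_pos v_less_1 v_out harmonic
    by (intro exI[of _ "\<lambda>x. 1 - v x"]) (simp add: p_laplacian_one_minus_eq_0_iff)
qed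

section \<open>Non-parabolic sets of finite capacity from massive sets\<close>

text \<open>
  Green's formula for a finitely supported test function, over a finite set \<open>N\<close> of vertices that
  contains every edge on which the test function varies. The flux is antisymmetric, so the sums
  with \<open>\<phi> y\<close> and with \<open>\<phi> x\<close> are opposite, and each is a combination of p-Laplacians.
\<close>

lemma p_harmonic_sum_by_parts:
  assumes T: "finite T" "\<And>x. x \<notin> T \<Longrightarrow> \<phi> x = 0" "\<And>x. x \<in> T \<Longrightarrow> p_laplacian E \<mu> p u x = 0"
    and N: "finite N" "T \<subseteq> N" "\<And>x. x \<in> T \<Longrightarrow> E `` {x} \<subseteq> N"
  shows "(\<Sum>(x, y)\<in>N \<times> N. flux u x y * (\<phi> y - \<phi> x)) = 0"
proof -
  have anti: "flux u x y = - flux u y x" for x y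
    by (simp add: flux_def mu_sym[of x] abs_minus_commute algebra_simps)
  have row: "(\<Sum>y\<in>N. flux u x y * \<phi> x) = 0" for x
  proof (cases "x \<in> T")
    case True
    have "(\<Sum>y\<in>N. flux u x y) = (\<Sum>y\<in>E `` {x}. flux u x y)"
      by (rule sum.mono_neutral_right) (use N True in \<open>auto simp: flux_def mu_zero\<close>)
    also have "\<dots> = 0" using T(3)[OF True] by (simp add: p_laplacian_eq_0_iff)
    finally show ?thesis by (simp flip: sum_distrib_right)
  next
    case False
    then show ?thesis by (simp add: T(2))
  qed
  have "(\<Sum>(x, y)\<in>N \<times> N. flux u x y * (\<phi> y - \<phi> x))
      = (\<Sum>x\<in>N. \<Sum>y\<in>N. flux u x y * \<phi> y) - (\<Sum>x\<in>N. \<Sum>y\<in>N. flux u x y * \<phi> x)"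
    by (simp add: sum.cartesian_product[symmetric] right_diff_distrib sum_subtractf)
  also have "(\<Sum>x\<in>N. \<Sum>y\<in>N. flux u x y * \<phi> y) = (\<Sum>y\<in>N. \<Sum>x\<in>N. flux u x y * \<phi> y)"
    by (rule sum.swap)
  also have "\<dots> = (\<Sum>y\<in>N. - (\<Sum>x\<in>N. flux u y x * \<phi> y))"
    by (intro sum.cong refl) (subst anti, simp add: sum_negf)
  finally show ?thesis by (simp add: row)
qed

lemma flux_abs: "\<bar>flux u x y\<bar> = \<mu> x y * \<bar>u y - u x\<bar> powr (p - 1)"
proof -
  have "\<bar>u y - u x\<bar> powr (p - 2) * \<bar>u y - u x\<bar> = \<bar>u y - u x\<bar> powr (p - 1)"
    using powr_add[of "\<bar>u y - u x\<bar>" "p - 2" 1] by (cases "u y = u x") auto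
  then show ?thesis by (simp add: flux_def abs_mult mu_nonneg mult.assoc)
qed

lemma flux_mult_nonpos:
  assumes "(u y - u x) * c \<le> 0"
  shows "flux u x y * c \<le> 0"
  using mult_nonneg_nonpos[OF _ assms, of "\<mu> x y * \<bar>u y - u x\<bar> powr (p - 2)"] mu_nonneg[of x y]
  by (simp add: flux_def mult.assoc)

lemma flux_young:
  assumes "0 < \<delta>"
  shows "\<bar>flux u x y\<bar> * \<bar>f y - f x\<bar>
    \<le> \<delta> * edge_energy \<mu> p u (x, y) + \<delta> powr (1 - p) * edge_energy \<mu> p f (x, y)"
  using mult_left_mono[OF abs_powr_young[OF p_gt_1 assms, of "u y - u x" "f y - f x"] mu_nonneg[of x y]]
  by (simp add: flux_abs edge_energy_def abs_minus_commute algebra_simps)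

text \<open>
  The equation for \<open>u\<close> is tested with \<open>\<phi> = f * max 0 (s - u)\<close>. On a pair inside \<open>W\<close>, the part of
  \<open>\<phi> y - \<phi> x\<close> that contains the difference of \<open>s - u\<close> has the sign opposite to the flux, and the part
  that contains the difference of \<open>f\<close> is bounded by Young's inequality. On a pair that leaves \<open>W\<close>,
  \<open>\<phi>\<close> vanishes at the outer end and the product again has the good sign. What
  remains is the pair \<open>(x0, y0)\<close>, whose contribution is, up to sign, the left-hand side; it is bounded by the error terms of all the pairs inside \<open>W\<close>.
\<close>

lemma sublevel_flux_bound:
  assumes W: "W = {x. u x < s}" "\<And>x. x \<in> W \<Longrightarrow> p_laplacian E \<mu> p u x = 0"
    and u: "\<And>x. 0 \<le> u x" "s \<le> 1"
    and f: "finite {x \<in> W. f x \<noteq> 0}" "\<And>x. 0 \<le> f x"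
    and x0: "x0 \<in> W" "f x0 = 1" "y0 \<notin> W" "(x0, y0) \<in> E"
    and \<delta>: "0 < \<delta>"
    and a: "p_energy \<mu> p UNIV u \<le> ennreal a" "0 \<le> a" and b: "p_energy \<mu> p W f \<le> ennreal b" "0 \<le> b"
  shows "flux u x0 y0 * (s - u x0) \<le> \<delta> * (2 * a) + \<delta> powr (1 - p) * (2 * b)"
proof -
  define w where "w = (\<lambda>x. max 0 (s - u x))"
  define \<phi> where "\<phi> = (\<lambda>x. f x * w x)"
  define T where "T = {x \<in> W. f x \<noteq> 0}"
  define N where "N = T \<union> (\<Union>x\<in>T. E `` {x})"
  let ?err = "\<lambda>z. \<delta> * edge_energy \<mu> p u z + \<delta> powr (1 - p) * edge_energy \<mu> p f z"
  define B where "B = N \<times> N \<inter> W \<times> W"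
  have w01: "0 \<le> w x" "w x \<le> 1" for x using u(1)[of x] u(2) by (auto simp: w_def)
  have w_out: "w x = 0" if "x \<notin> W" for x using that W(1) by (auto simp: w_def)
  have w_in: "w x = s - u x" if "x \<in> W" for x using that W(1) by (auto simp: w_def)
  have "finite T" using f(1) by (simp add: T_def)
  then have "finite N" by (simp add: N_def)
  have "x0 \<in> T" using x0 by (simp add: T_def)
  then have e0: "(x0, y0) \<in> N \<times> N" using x0(4) by (auto simp: N_def)
  have zero: "(\<Sum>(x, y)\<in>N \<times> N. flux u x y * (\<phi> y - \<phi> x)) = 0"
    by (rule p_harmonic_sum_by_parts[OF \<open>finite T\<close> _ _ \<open>finite N\<close>])
       (use w_out W(2) in \<open>auto simp: T_def N_def \<phi>_def\<close>)
  have pairwise: "flux u x y * (\<phi> y - \<phi> x) \<le> (if (x, y) \<in> W \<times> W then ?err (x, y) else 0)" for x y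
  proof -
    consider "x \<in> W" "y \<in> W" | "x \<in> W" "y \<notin> W" | "x \<notin> W" "y \<in> W" | "x \<notin> W" "y \<notin> W" by blast
    then show ?thesis
    proof cases
      case 1
      \<comment> \<open>Discrete product rule for \<open>f * w\<close>, where \<open>w y - w x = u x - u y\<close>.\<close>
      have "\<phi> y - \<phi> x = f x * (u x - u y) + w y * (f y - f x)"
        using 1 by (simp add: \<phi>_def w_in algebra_simps)
      then have "flux u x y * (\<phi> y - \<phi> x)
          = flux u x y * (f x * (u x - u y)) + flux u x y * (w y * (f y - f x))"
        by (simp add: distrib_left)
      moreover have "(u y - u x) * (f x * (u x - u y)) \<le> 0"
      proof -
        have "(u y - u x) * (f x * (u x - u y)) = - (f x * (u x - u y)\<^sup>2)"
          by (simp add: power2_eq_square algebra_simps)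
        then show ?thesis using f(2)[of x] by simp
      qed
      from flux_mult_nonpos[OF this] have "flux u x y * (f x * (u x - u y)) \<le> 0" .
      moreover have "flux u x y * (w y * (f y - f x)) \<le> \<bar>flux u x y\<bar> * \<bar>f y - f x\<bar>"
      proof -
        have "flux u x y * (w y * (f y - f x)) \<le> \<bar>flux u x y * (w y * (f y - f x))\<bar>" by simp
        also have "\<dots> = w y * (\<bar>flux u x y\<bar> * \<bar>f y - f x\<bar>)" using w01(1) by (simp add: abs_mult)
        also have "\<dots> \<le> 1 * (\<bar>flux u x y\<bar> * \<bar>f y - f x\<bar>)"
          using w01(2) by (intro mult_right_mono) auto
        finally show ?thesis by simp
      qed
      ultimately show ?thesis using flux_young[OF \<delta>, of u x y f] 1 by simp
    next
      case 2
      then have "u x < s" "s \<le> u y" using W(1) by auto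
      then have "(u y - u x) * (\<phi> y - \<phi> x) \<le> 0"
        using f(2) 2 by (intro mult_nonneg_nonpos) (auto simp: \<phi>_def w_out w_in)
      from flux_mult_nonpos[OF this] show ?thesis using 2 by simp
    next
      case 3
      then have "u y < s" "s \<le> u x" using W(1) by auto
      then have "(u y - u x) * (\<phi> y - \<phi> x) \<le> 0"
        using f(2) 3 by (intro mult_nonpos_nonneg) (auto simp: \<phi>_def w_out w_in)
      from flux_mult_nonpos[OF this] show ?thesis using 3 by simp
    next
      case 4
      then show ?thesis by (simp add: \<phi>_def w_out)
    qed
  qed
  have "0 = flux u x0 y0 * (\<phi> y0 - \<phi> x0)
      + (\<Sum>(x, y)\<in>N \<times> N - {(x0, y0)}. flux u x y * (\<phi> y - \<phi> x))"
    using sum.remove[OF _ e0, of "\<lambda>(x, y). flux u x y * (\<phi> y - \<phi> x)"] \<open>finite N\<close> zero by simp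
  also have "flux u x0 y0 * (\<phi> y0 - \<phi> x0) = - (flux u x0 y0 * (s - u x0))"
    using x0 by (simp add: \<phi>_def w_out w_in right_diff_distrib)
  also have "(\<Sum>(x, y)\<in>N \<times> N - {(x0, y0)}. flux u x y * (\<phi> y - \<phi> x))
      \<le> (\<Sum>z\<in>N \<times> N - {(x0, y0)}. if z \<in> W \<times> W then ?err z else 0)"
  proof (rule sum_mono)
    fix z
    show "(case z of (x, y) \<Rightarrow> flux u x y * (\<phi> y - \<phi> x)) \<le> (if z \<in> W \<times> W then ?err z else 0)"
      using pairwise[of "fst z" "snd z"] by (cases z) (simp only: prod.case fst_conv snd_conv)
  qed
  also have "\<dots> = (\<Sum>z\<in>B. ?err z)"
    using \<open>finite N\<close> x0(3) unfolding B_def by (intro sum.mono_neutral_cong_right) auto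
  also have "\<dots> = \<delta> * sum (edge_energy \<mu> p u) B + \<delta> powr (1 - p) * sum (edge_energy \<mu> p f) B"
    by (simp add: sum.distrib sum_distrib_left)
  also have "\<dots> \<le> \<delta> * (2 * a) + \<delta> powr (1 - p) * (2 * b)"
  proof -
    have "finite B" "B \<subseteq> W \<times> W" using \<open>finite N\<close> by (auto simp: B_def)
    then have "sum (edge_energy \<mu> p u) B \<le> 2 * a" "sum (edge_energy \<mu> p f) B \<le> 2 * b"
      using sum_edge_energy_le_p_energy[OF a] sum_edge_energy_le_p_energy[OF b] by auto
    then show ?thesis using \<delta> by (intro add_mono mult_left_mono) auto
  qed
  finally show ?thesis by linarith
qed

text \<open>
  The set is \<open>{u < s}\<close> for a massive function \<open>u\<close>. The flux through an edge that leaves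
  it is positive, and \<open>sublevel_flux_bound\<close> would make it arbitrarily small if the set were parabolic.
\<close>

lemma nonparabolic_sublevel_if_massive:
  assumes "Dp_massive E \<mu> p \<Omega>" "\<Omega> \<noteq> {}" "- \<Omega> \<noteq> {}"
  shows "\<exists>\<Omega>1\<subseteq>\<Omega>. \<not> p_parabolic \<mu> p \<Omega>1 \<and> p_capacity \<mu> p \<Omega>1 \<Omega> < \<infinity>"
proof -
  obtain u where u: "\<And>x. x \<in> \<Omega> \<Longrightarrow> 0 < u x \<and> u x < 1"
    "\<And>x. x \<in> \<Omega> \<Longrightarrow> p_laplacian E \<mu> p u x = 0" "\<And>x. x \<notin> \<Omega> \<Longrightarrow> u x = 1"
    "p_energy \<mu> p UNIV u < \<infinity>"
    using assms(1) unfolding Dp_massive_def by auto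
  obtain a where a: "p_energy \<mu> p UNIV u = ennreal a" "0 \<le> a"
    using u(4) by (cases "p_energy \<mu> p UNIV u") auto
  obtain z where z: "z \<in> \<Omega>" using assms(2) by blast
  obtain s where s: "u z < s" "s < 1" using u(1)[OF z] dense by blast
  define W where "W = {x. u x < s}"
  have "z \<in> W" using s by (simp add: W_def)
  have W\<Omega>: "W \<subseteq> \<Omega>" using u(3) s by (force simp: W_def)
  have u_nonneg: "0 \<le> u x" for x using u(1,3)[of x] by (cases "x \<in> \<Omega>") auto
  have "W \<noteq> UNIV" using W\<Omega> assms(3) by auto
  then obtain x0 y0 where e0: "x0 \<in> W" "(x0, y0) \<in> E" "y0 \<notin> W"
    using closed_under_neighbours_eq_UNIV[OF \<open>z \<in> W\<close>] by blast
  have "\<not> p_parabolic \<mu> p W"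
  proof
    assume "p_parabolic \<mu> p W"
    then have zero: "p_conductance_to_infinity \<mu> p {x0} W = 0"
      using e0 by (auto simp: p_parabolic_def)
    define \<kappa> where "\<kappa> = flux u x0 y0 * (s - u x0)"
    have lt: "u x0 < s" "s \<le> u y0" using e0 by (auto simp: W_def)
    then have "0 < \<kappa>" using e0(2) mu_pos_iff[of x0 y0] by (simp add: \<kappa>_def flux_def)
    \<comment> \<open>With \<open>\<delta>\<close> and \<open>b\<close>, the two error terms of the bound are less than \<open>\<kappa> / 2\<close> and equal to \<open>\<kappa> / 2\<close>.\<close>
    define \<delta> where "\<delta> = \<kappa> / (4 * (a + 1))"
    have "0 < \<delta>" using \<open>0 < \<kappa>\<close> a(2) by (simp add: \<delta>_def)
    define b where "b = \<kappa> / (4 * \<delta> powr (1 - p))"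
    have "0 < b" using \<open>0 < \<kappa>\<close> \<open>0 < \<delta>\<close> by (simp add: b_def)
    then have "p_conductance_to_infinity \<mu> p {x0} W < ennreal b" using zero by simp
    then obtain h where h: "finite {x \<in> W. h x \<noteq> 0}" "h x0 = 1" "p_energy \<mu> p W h < ennreal b"
      unfolding p_conductance_to_infinity_def Inf_less_iff by auto
    have "p_energy \<mu> p W (\<lambda>x. \<bar>h x\<bar>) \<le> ennreal (1 powr p) * p_energy \<mu> p W h"
      by (rule p_energy_contraction) (use p_pos in auto)
    then have "p_energy \<mu> p W (\<lambda>x. \<bar>h x\<bar>) \<le> ennreal b" using h(3) by simp
    then have "\<kappa> \<le> \<delta> * (2 * a) + \<delta> powr (1 - p) * (2 * b)"
      unfolding \<kappa>_def
      by (intro sublevel_flux_bound[where f = "\<lambda>x. \<bar>h x\<bar>" and W = W])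
         (use u(2) W\<Omega> u_nonneg s h e0 a \<open>0 < \<delta>\<close> \<open>0 < b\<close> in \<open>auto simp: W_def\<close>)
    moreover have "\<delta> * (2 * a) < \<kappa> / 2"
      using \<open>0 < \<kappa>\<close> a(2) by (simp add: \<delta>_def field_simps)
    moreover have "\<delta> powr (1 - p) * (2 * b) = \<kappa> / 2"
      using \<open>0 < \<delta>\<close> by (simp add: b_def)
    ultimately show False by linarith
  qed
  moreover have "p_capacity \<mu> p W \<Omega> < \<infinity>"
  proof -
    define f where "f = (\<lambda>x. min 1 ((1 / (1 - s)) * (1 - u x)))"
    have f1: "\<forall>x\<in>W. f x = 1" using s by (auto simp: f_def W_def field_simps)
    have f0: "\<forall>x\<in>- \<Omega>. f x = 0" using u(3) by (simp add: f_def)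
    have "\<bar>f x - f y\<bar> \<le> (1 / (1 - s)) * \<bar>u x - u y\<bar>" for x y
    proof -
      have "\<bar>f x - f y\<bar> \<le> \<bar>(1 / (1 - s)) * (1 - u x) - (1 / (1 - s)) * (1 - u y)\<bar>"
        unfolding f_def by (auto simp: min_def)
      also have "\<dots> = \<bar>(u y - u x) / (1 - s)\<bar>" by (simp add: diff_divide_distrib)
      also have "\<dots> = (1 / (1 - s)) * \<bar>u x - u y\<bar>" using s by (simp add: abs_minus_commute)
      finally show ?thesis .
    qed
    then have "p_energy \<mu> p UNIV f \<le> ennreal ((1 / (1 - s)) powr p) * p_energy \<mu> p UNIV u"
      using s p_pos by (intro p_energy_contraction) auto
    also have "\<dots> < \<infinity>" using u(4) by (simp add: ennreal_mult_less_top)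
    finally have fin: "p_energy \<mu> p UNIV f < \<infinity>" .
    have "p_capacity \<mu> p W \<Omega> \<le> p_energy \<mu> p UNIV f"
      unfolding p_capacity_def p_conductance_def using f0 f1 fin by (intro Inf_lower) blast
    then show ?thesis using fin by (rule le_less_trans)
  qed
  ultimately show ?thesis using W\<Omega> by blast
qed

end

theorem theorem1p9:
  fixes E :: "('a \<times> 'a) set" and \<mu> :: "'a \<Rightarrow> 'a \<Rightarrow> real" and p :: real and \<Omega> :: "'a set"
  assumes "1 < p"
    and "weighted_graph E \<mu>"
    and "infinite (UNIV :: 'a set)"
    and "connected_subgraph E UNIV"
    and "locally_finite_graph E"
    and "infinite \<Omega>"
    and "- \<Omega> \<noteq> {}"
  shows "(Dp_massive E \<mu> p \<Omega> \<longrightarrow>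
            (\<exists>\<Omega>1\<subseteq>\<Omega>. \<not> p_parabolic \<mu> p \<Omega>1 \<and> p_capacity \<mu> p \<Omega>1 \<Omega> < \<infinity>)) \<and>
         (connected_subgraph E \<Omega> \<longrightarrow>
            (\<exists>\<Omega>1\<subseteq>\<Omega>. \<not> p_parabolic \<mu> p \<Omega>1 \<and> p_capacity \<mu> p \<Omega>1 \<Omega> < \<infinity>) \<longrightarrow>
            Dp_massive E \<mu> p \<Omega>)"
proof -
  interpret weighted_graph E \<mu> by (rule assms(2))
  interpret p_network E \<mu> p
    by unfold_locales (use assms in auto)
  have "\<Omega> \<noteq> {}" using assms(6) by auto
  then show ?thesis
    using nonparabolic_sublevel_if_massive[of \<Omega>] massive_if_nonparabolic_finite_capacity[of \<Omega>] assms(7)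
    by blast
qed

end
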